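(* Let $X$ be a path connected, locally path connected, semilocally simply connected and locally compact (Hausdorff) topological group. Then its (topological) fundamental groupoid $\Pi_1(X)$ has a Haar system.
   Context: **Fundamental groupoid.** $\Pi_1(X)$ is the groupoid of endpoint-fixing homotopy classes $[\gamma]$ of paths $\gamma\colon[0,1]\to X$, with range $r([\gamma])=\gamma(1)$, source $s([\gamma])=\gamma(0)$, and unit space $X$ (constant paths). The product $[\gamma][\delta]$ is defined when $\gamma(0)=\delta(1)$ and is the class of the concatenation "first $\delta$, then $\gamma$", written $[\gamma * \delta]$. For $X$ locally path connected and semilocally simply connected, $\Pi_1(X)$ is topologised as the quotient of the path space with the compact-open topology. Equivalently, a basis is given by the sets $N([\gamma],U,V)=\{[\delta * \gamma * \omega] : \delta \text{ a path in } U,\ \delta(0)=\gamma(1),\ \omega \text{ a path in } V,\ \omega(1)=\gamma(0)\}$, where $U,V\subseteq X$ are path connected open sets whose inclusions into $X$ induce trivial maps on fundamental groups, and $\gamma$ is a path with $\gamma(0)\in V$, $\gamma(1)\in U$. This makes $\Pi_1(X)$ a topological groupoid. **Haar system.** For a locally compact groupoid $G$ with unit space $G^{(0)}$, put $G^u=r^{-1}(u)$. A Haar system on $G$ is a family $\{\alpha^u\}_{u\in G^{(0)}}$ of positive Radon measures on $G$ such that: $\alpha^u$ has support $G^u$; for every $f\in C_c(G)$ the function $u\mapsto\int f\,d\alpha^u$ is in $C_c(G^{(0)})$; and for all $\gamma\in G$, $f\in C_c(G)$, $\int_{G^{s(\gamma)}} f(\gamma\eta)\,d\alpha^{s(\gamma)}(\eta)=\int_{G^{r(\gamma)}}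 f(\eta)\,d\alpha^{r(\gamma)}(\eta)$. *)

theory Defs
  imports "HOL-Analysis.Analysis"
begin

section \<open>Topological preliminaries\<close>

definition quotient_topology :: "'a topology \<Rightarrow> ('a \<Rightarrow> 'b) \<Rightarrow> 'b topology" where
  "quotient_topology T q =
     topology (\<lambda>W. W \<subseteq> q ` topspace T \<and> openin T {x \<in> topspace T. q x \<in> W})"

lemma openin_quotient_topology:
  "openin (quotient_topology T q) W \<longleftrightarrow>
     W \<subseteq> q ` topspace T \<and> openin T {x \<in> topspace T. q x \<in> W}"
proof -
  have "istopology (\<lambda>W. W \<subseteq> q ` topspace T \<and> openin T {x \<in> topspace T. q x \<in> W})"
    unfolding istopology_def
  proof (intro conjI allI impI; (elim conjE)?)
    fix S S' assume "openin T {x \<in> topspace T. q x \<in> S}" "openin T {x \<in> topspace T. q x \<in> S'}"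
    moreover have "{x \<in> topspace T. q x \<in> S \<inter> S'} =
        {x \<in> topspace T. q x \<in> S} \<inter> {x \<in> topspace T. q x \<in> S'}"
      by auto
    ultimately show "openin T {x \<in> topspace T. q x \<in> S \<inter> S'}"
      by (simp add: openin_Int)
  next
    fix \<K> assume *: "\<forall>K\<in>\<K>. K \<subseteq> q ` topspace T \<and> openin T {x \<in> topspace T. q x \<in> K}"
    have "{x \<in> topspace T. q x \<in> \<Union>\<K>} = (\<Union>K\<in>\<K>. {x \<in> topspace T. q x \<in> K})"
      by auto
    moreover have "openin T (\<Union>K\<in>\<K>. {x \<in> topspace T. q x \<in> K})"
      using * by (intro openin_Union) blast
    ultimately show "openin T {x \<in> topspace T. q x \<in> \<Union>\<K>}"
      by simp
  qed blast+
  then show ?thesis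
    by (simp add: quotient_topology_def topology_inverse')
qed

lemma topspace_quotient_topology [simp]: "topspace (quotient_topology T q) = q ` topspace T"
proof -
  have "{x \<in> topspace T. q x \<in> q ` topspace T} = topspace T"
    by auto
  then have "openin (quotient_topology T q) (q ` topspace T)"
    by (simp add: openin_quotient_topology)
  then show ?thesis
    using openin_quotient_topology[of T q "topspace (quotient_topology T q)"] openin_subset
    by (metis openin_topspace subset_antisym)
qed

lemma quotient_map_quotient_topology: "quotient_map T (quotient_topology T q) q"
  by (simp add: quotient_map_def openin_quotient_topology)

definition semilocally_simply_connected :: "'a::topological_space set \<Rightarrow> bool" where
  "semilocally_simply_connected S \<longleftrightarrow>
     (\<forall>x\<in>S. \<exists>U. openin (top_of_set S) U \<and> x \<in> U \<and>
        (\<forall>p. path p \<and> path_image p \<subseteq> U \<and> pathstart p = x \<and> pathfinish p = x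
             \<longrightarrow> homotopic_paths S p (\<lambda>_. x)))"

definition continuous_compact_support :: "'a topology \<Rightarrow> ('a \<Rightarrow> complex) set" where
  "continuous_compact_support T =
     {f. continuous_map T euclidean f \<and> compactin T (T closure_of {x \<in> topspace T. f x \<noteq> 0})}"


section \<open>Radon measures\<close>

definition borel_of :: "'a topology \<Rightarrow> 'a measure" where
  "borel_of T = sigma (topspace T) {U. openin T U}"

definition radon_measure :: "'a topology \<Rightarrow> 'a measure \<Rightarrow> bool" where
  "radon_measure T M \<longleftrightarrow>
     sets M = sets (borel_of T) \<and>
     (\<forall>K. compactin T K \<longrightarrow> emeasure M K < \<infinity>) \<and>
     (\<forall>A\<in>sets M. emeasure M A = (INF U\<in>{U. openin T U \<and> A \<subseteq> U}. emeasure M U)) \<and>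
     (\<forall>U. openin T U \<longrightarrow>
        emeasure M U = (SUP K\<in>{K. compactin T K \<and> K \<subseteq> U}. emeasure M K))"

definition measure_support :: "'a topology \<Rightarrow> 'a measure \<Rightarrow> 'a set" where
  "measure_support T M = topspace T - \<Union>{U. openin T U \<and> emeasure M U = 0}"


section \<open>Topological groupoids and Haar systems\<close>

text \<open>
  Units and arrows are kept as separate spaces, the unit at \<open>u\<close> being the arrow \<open>gident G u\<close>.
  The product \<open>gmult G x y\<close> is meaningful only if \<open>gsource G x = grange G y\<close>.
\<close>

record ('u, 'a) groupoid =
  gunits :: "'u topology"
  garrows :: "'a topology"
  grange :: "'a \<Rightarrow> 'u"
  gsource :: "'a \<Rightarrow> 'u"
  gident :: "'u \<Rightarrow> 'a"
  gmult :: "'a \<Rightarrow> 'a \<Rightarrow> 'a"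
  ginv :: "'a \<Rightarrow> 'a"

definition composable :: "('u, 'a) groupoid \<Rightarrow> ('a \<times> 'a) set" where
  "composable G =
     {(x, y). x \<in> topspace (garrows G) \<and> y \<in> topspace (garrows G) \<and> gsource G x = grange G y}"

definition range_fibre :: "('u, 'a) groupoid \<Rightarrow> 'u \<Rightarrow> 'a set" where
  "range_fibre G u = {x \<in> topspace (garrows G). grange G x = u}"

locale topological_groupoid =
  fixes G :: "('u, 'a) groupoid"
  assumes continuous_range: "continuous_map (garrows G) (gunits G) (grange G)"
    and continuous_source: "continuous_map (garrows G) (gunits G) (gsource G)"
    and continuous_ident: "continuous_map (gunits G) (garrows G) (gident G)"
    and continuous_mult:
      "continuous_map (subtopology (prod_topology (garrows G) (garrows G)) (composable G))
         (garrows G) (\<lambda>(x, y). gmult G x y)"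
    and continuous_inv: "continuous_map (garrows G) (garrows G) (ginv G)"
    and range_ident: "u \<in> topspace (gunits G) \<Longrightarrow> grange G (gident G u) = u"
    and source_ident: "u \<in> topspace (gunits G) \<Longrightarrow> gsource G (gident G u) = u"
    and range_mult: "(x, y) \<in> composable G \<Longrightarrow> grange G (gmult G x y) = grange G x"
    and source_mult: "(x, y) \<in> composable G \<Longrightarrow> gsource G (gmult G x y) = gsource G y"
    and mult_assoc: "\<lbrakk>(x, y) \<in> composable G; (y, z) \<in> composable G\<rbrakk>
      \<Longrightarrow> gmult G (gmult G x y) z = gmult G x (gmult G y z)"
    and ident_mult: "x \<in> topspace (garrows G) \<Longrightarrow> gmult G (gident G (grange G x)) x = x"
    and mult_ident: "x \<in> topspace (garrows G) \<Longrightarrow> gmult G x (gident G (gsource G x)) = x"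
    and range_inv: "x \<in> topspace (garrows G) \<Longrightarrow> grange G (ginv G x) = gsource G x"
    and source_inv: "x \<in> topspace (garrows G) \<Longrightarrow> gsource G (ginv G x) = grange G x"
    and mult_inv: "x \<in> topspace (garrows G)
      \<Longrightarrow> gmult G x (ginv G x) = gident G (grange G x)"
    and inv_mult: "x \<in> topspace (garrows G)
      \<Longrightarrow> gmult G (ginv G x) x = gident G (gsource G x)"

locale locally_compact_groupoid = topological_groupoid G
  for G :: "('u, 'a) groupoid" +
  assumes locally_compact_arrows: "locally_compact_space (garrows G)"
    and Hausdorff_arrows: "Hausdorff_space (garrows G)"

locale haar_system = locally_compact_groupoid G
  for G :: "('u, 'a) groupoid" +
  fixes \<alpha> :: "'u \<Rightarrow> 'a measure"
  assumes radon: "u \<in> topspace (gunits G) \<Longrightarrow> radon_measure (garrows G) (\<alpha> u)"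
    and support: "u \<in> topspace (gunits G)
      \<Longrightarrow> measure_support (garrows G) (\<alpha> u) = range_fibre G u"
    and continuity: "f \<in> continuous_compact_support (garrows G)
      \<Longrightarrow> (\<lambda>u. LINT x|\<alpha> u. f x) \<in> continuous_compact_support (gunits G)"
    and left_invariance:
      "\<lbrakk>x \<in> topspace (garrows G); f \<in> continuous_compact_support (garrows G)\<rbrakk>
       \<Longrightarrow> (LINT y:range_fibre G (gsource G x)|\<alpha> (gsource G x). f (gmult G x y)) =
           (LINT y:range_fibre G (grange G x)|\<alpha> (grange G x). f y)"


section \<open>The fundamental groupoid\<close>

text \<open>
  Following the library, a path is a function on \<open>real\<close> of which only the values on \<open>{0..1}\<close>
  matter. Functions agreeing on \<open>{0..1}\<close> are not identified in \<open>path_space\<close>, but they lie in the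
  same open sets and are homotopic, so the quotient by homotopy is the usual one.
\<close>

definition path_space :: "(real \<Rightarrow> 'a::topological_space) topology" where
  "path_space = topology_generated_by
     {{p. path p \<and> p ` K \<subseteq> U} | K U. compact K \<and> K \<subseteq> {0..1} \<and> open U}"

definition path_class :: "(real \<Rightarrow> 'a::topological_space) \<Rightarrow> (real \<Rightarrow> 'a) set" where
  "path_class p = {q. homotopic_paths UNIV p q}"

text \<open>
  Range is the endpoint and source the starting point; \<open>c d\<close> is ``first \<open>d\<close>, then \<open>c\<close>'',
  whereas the library's \<open>q +++ p\<close> traverses \<open>q\<close> first.
\<close>

definition fundamental_groupoid :: "('a::topological_space, (real \<Rightarrow> 'a) set) groupoid" where
  "fundamental_groupoid =
     \<lparr>gunits = euclidean,
      garrows = quotient_topology path_space path_class,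
      grange = (\<lambda>c. the_elem (pathfinish ` c)),
      gsource = (\<lambda>c. the_elem (pathstart ` c)),
      gident = (\<lambda>x. path_class (\<lambda>_. x)),
      gmult = (\<lambda>c d. \<Union>p\<in>c. \<Union>q\<in>d. path_class (q +++ p)),
      ginv = (\<lambda>c. reversepath ` c)\<rparr>"

lemma topspace_path_space [simp]: "topspace path_space = Collect path"
proof -
  have "\<exists>K U. {p. path p} = {p :: real \<Rightarrow> 'a. path p \<and> p ` K \<subseteq> U} \<and>
      compact K \<and> K \<subseteq> {0..1} \<and> open U"
    by (intro exI[of _ "{}"] exI[of _ UNIV]) auto
  then show ?thesis
    unfolding path_space_def topology_generated_by_topspace by blast
qed

end

theory Submission
  imports Defs
begin

text \<open>
  Homotopy classes of paths in a topological group \<open>X\<close> form a topological group \<open>P\<close> under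
  pointwise addition: null-homotopic loops at \<open>0\<close> are a normal subgroup of the path space, and
  \<open>P\<close> is the quotient. Range, source and the constant paths are continuous homomorphisms, and
  the groupoid product of \<open>x\<close> and \<open>y\<close> composable at \<open>s\<close> is \<open>x - s + y\<close> computed in \<open>P\<close>,
  where \<open>s\<close> stands for the constant path. The homomorphism \<open>(range, source)\<close> from \<open>P\<close> to
  \<open>X \<times> X\<close> is a local homeomorphism, so that \<open>P\<close> is locally compact and Hausdorff, and so is the
  kernel \<open>H\<close> of the range homomorphism.

  Let \<open>\<mu>\<close> be a left Haar measure on \<open>H\<close> and let \<open>\<alpha> u\<close> be its image under \<open>h \<mapsto> u + h\<close>, a
  homeomorphism from \<open>H\<close> onto the range fibre over \<open>u\<close>. Multiplying \<open>s + h\<close> on the left by an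
  arrow \<open>x\<close> from \<open>s\<close> to \<open>r\<close> gives \<open>x + h = r + ((- r + x) + h)\<close> with \<open>- r + x\<close> in \<open>H\<close>, so left
  invariance of the system is left invariance of \<open>\<mu>\<close>. The Haar measure itself is obtained from
  ratios of covering numbers: a cluster point of these, as the covering set shrinks, is an
  additive invariant content on compact sets, which extends to a Radon measure.
\<close>

section \<open>Covering numbers in topological groups\<close>

lemma mem_translate_iff: "x \<in> (+) a ` S \<longleftrightarrow> - a + x \<in> S" for a x :: "'a::group_add"
  by (metis (no_types, lifting) add.assoc add.left_neutral add_uminus_conv_diff diff_add_cancel
      image_iff neg_eq_iff_add_eq_0 minus_add_cancel)

lemma translate_eq_vimage: "(+) a ` S = (\<lambda>x. - a + x) -` S" for a :: "'a::group_add"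
  using mem_translate_iff[of _ a S] by auto

lemma open_translate: "open S \<Longrightarrow> open ((+) a ` S)" for a :: "'a::topological_group_add"
  unfolding translate_eq_vimage by (intro open_vimage continuous_intros)

lemma compact_translate: "compact S \<Longrightarrow> compact ((+) a ` S)" for a :: "'a::topological_group_add"
  by (intro compact_continuous_image continuous_intros)

lemma translate_translate: "(+) a ` (+) b ` S = (+) (a + b) ` S" for a b :: "'a::group_add"
  by (force simp: image_image add.assoc)

lemma compact_add_nbhd_subset:
  fixes K :: "'a::topological_group_add set"
  assumes "compact K" "open U" "K \<subseteq> U"
  obtains V where "open V" "0 \<in> V" "\<And>x v. x \<in> K \<Longrightarrow> v \<in> V \<Longrightarrow> x + v \<in> U"
proof -
  have "open ((\<lambda>p. snd p + fst p) -` U)"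
    by (intro open_vimage assms continuous_intros)
  moreover have "{0} \<times> K \<subseteq> (\<lambda>p. snd p + fst p) -` U"
    using assms(3) by auto
  ultimately have "\<exists>V. 0 \<in> V \<and> open V \<and> V \<times> K \<subseteq> (\<lambda>p. snd p + fst p) -` U"
    by (rule Elementary_Topology.tube_lemma[OF assms(1)])
  then obtain V where V: "0 \<in> V" "open V" "V \<times> K \<subseteq> (\<lambda>p. snd p + fst p) -` U"
    by blast
  show thesis
  proof (rule that[OF V(2,1)])
    show "x + v \<in> U" if "x \<in> K" "v \<in> V" for x v
      using subsetD[OF V(3), of "(v, x)"] that by simp
  qed
qed

lemma nbhd_0_diff_subset:
  assumes "open U" "(0::'a::topological_group_add) \<in> U"
  obtains V where "open V" "0 \<in> V" "\<And>x y. x \<in> V \<Longrightarrow> y \<in> V \<Longrightarrow> x - y \<in> U"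
proof -
  have "open ((\<lambda>p::'a \<times> 'a. fst p - snd p) -` U)"
    by (intro open_vimage assms continuous_intros)
  moreover have "(0, 0) \<in> (\<lambda>p::'a \<times> 'a. fst p - snd p) -` U"
    using assms(2) by auto
  ultimately obtain A B where "open A" "open B" "(0, 0) \<in> A \<times> B"
      "A \<times> B \<subseteq> (\<lambda>p::'a \<times> 'a. fst p - snd p) -` U"
    by (rule open_prod_elim)
  then show thesis
    by (intro that[of "A \<inter> B"]) auto
qed

lemma disjoint_compact_add_nbhd:
  fixes K L :: "'a::topological_group_add set"
  assumes "compact K" "closed L" "K \<inter> L = {}"
  obtains V where "open V" "0 \<in> V"
    "\<And>x y v w. x \<in> K \<Longrightarrow> y \<in> L \<Longrightarrow> v \<in> V \<Longrightarrow> w \<in> V \<Longrightarrow> x + v \<noteq> y + w"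
proof -
  obtain U where U: "open U" "0 \<in> U" "\<And>x v. x \<in> K \<Longrightarrow> v \<in> U \<Longrightarrow> x + v \<in> - L"
    using compact_add_nbhd_subset[of K "- L"] assms by blast
  obtain V where V: "open V" "0 \<in> V" "\<And>x y. x \<in> V \<Longrightarrow> y \<in> V \<Longrightarrow> x - y \<in> U"
    using nbhd_0_diff_subset[OF U(1,2)] by blast
  show thesis
  proof (rule that[OF V(1,2)])
    fix x y v w assume *: "x \<in> K" "y \<in> L" "v \<in> V" "w \<in> V"
    show "x + v \<noteq> y + w"
    proof
      assume "x + v = y + w"
      then have "x + (v - w) = y"
        by (metis add_diff_cancel add_diff_eq)
      then show False
        using U(3)[OF *(1) V(3)[OF *(3,4)]] *(2) by auto
    qed
  qed
qed

definition covering_number :: "'a::topological_group_add set \<Rightarrow> 'a set \<Rightarrow> nat" where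
  "covering_number V K =
     (LEAST n. \<exists>A. finite A \<and> card A = n \<and> K \<subseteq> (\<Union>a\<in>A. (+) a ` V))"

lemma covering_number_le:
  assumes "finite A" "K \<subseteq> (\<Union>a\<in>A. (+) a ` V)"
  shows "covering_number V K \<le> card A"
  unfolding covering_number_def using assms by (intro Least_le) auto

lemma finite_translates_cover:
  assumes "compact K" "open V" "V \<noteq> {}"
  obtains A where "finite A" "K \<subseteq> (\<Union>a\<in>A. (+) (a :: 'a::topological_group_add) ` V)"
proof -
  obtain v where v: "v \<in> V"
    using assms by auto
  have "K \<subseteq> (\<Union>a\<in>UNIV. (+) a ` V)"
  proof
    fix x assume "x \<in> K"
    have "x \<in> (+) (x - v) ` V"
      using v by (simp add: mem_translate_iff minus_diff_eq)
    then show "x \<in> (\<Union>a\<in>UNIV. (+) a ` V)"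
      by blast
  qed
  then obtain A where "A \<subseteq> UNIV" "finite A" "K \<subseteq> (\<Union>a\<in>A. (+) a ` V)"
    using compactE_image[OF assms(1), of UNIV "\<lambda>a. (+) a ` V"] open_translate[OF assms(2)]
    by metis
  then show thesis
    using that by blast
qed

lemma covering_number_witness:
  assumes "compact K" "open V" "V \<noteq> {}"
  obtains A where "finite A" "card A = covering_number V K" "K \<subseteq> (\<Union>a\<in>A. (+) a ` V)"
proof -
  obtain B where B: "finite B" "K \<subseteq> (\<Union>a\<in>B. (+) a ` V)"
    using finite_translates_cover[OF assms] .
  have "\<exists>A. finite A \<and> card A = covering_number V K \<and> K \<subseteq> (\<Union>a\<in>A. (+) a ` V)"
    unfolding covering_number_def by (rule LeastI[of _ "card B"]) (use B in auto)
  then show thesis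
    using that by blast
qed

lemma covering_number_mono:
  assumes "compact L" "open V" "V \<noteq> {}" "K \<subseteq> L"
  shows "covering_number V K \<le> covering_number V L"
proof -
  obtain A where "finite A" "card A = covering_number V L" "L \<subseteq> (\<Union>a\<in>A. (+) a ` V)"
    using covering_number_witness[OF assms(1-3)] .
  then show ?thesis
    using covering_number_le[of A K V] assms(4) by auto
qed

lemma covering_number_Un_le:
  assumes "compact K" "compact L" "open V" "V \<noteq> {}"
  shows "covering_number V (K \<union> L) \<le> covering_number V K + covering_number V L"
proof -
  obtain A where A: "finite A" "card A = covering_number V K" "K \<subseteq> (\<Union>a\<in>A. (+) a ` V)"
    using covering_number_witness[OF assms(1,3,4)] .
  obtain B where B: "finite B" "card B = covering_number V L" "L \<subseteq> (\<Union>a\<in>B. (+) a ` V)"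
    using covering_number_witness[OF assms(2,3,4)] .
  have "covering_number V (K \<union> L) \<le> card (A \<union> B)"
    using A B by (intro covering_number_le) auto
  then show ?thesis
    using card_Un_le[of A B] A(2) B(2) by linarith
qed

lemma covering_number_translate_le:
  assumes "compact K" "open V" "V \<noteq> {}"
  shows "covering_number V ((+) g ` K) \<le> covering_number V K"
proof -
  obtain A where A: "finite A" "card A = covering_number V K" "K \<subseteq> (\<Union>a\<in>A. (+) a ` V)"
    using covering_number_witness[OF assms] .
  have "(+) g ` K \<subseteq> (\<Union>a\<in>(+) g ` A. (+) a ` V)"
  proof
    fix x assume "x \<in> (+) g ` K"
    then obtain k where "k \<in> K" "x = g + k"
      by auto
    moreover then obtain a v where "a \<in> A" "v \<in> V" "k = a + v"
      using A(3) by blast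
    ultimately have "x = (g + a) + v" "g + a \<in> (+) g ` A"
      by (auto simp: add.assoc)
    then show "x \<in> (\<Union>a\<in>(+) g ` A. (+) a ` V)"
      using \<open>v \<in> V\<close> by blast
  qed
  then have "covering_number V ((+) g ` K) \<le> card ((+) g ` A)"
    using A(1) by (intro covering_number_le) auto
  then show ?thesis
    using card_image_le[OF A(1), of "(+) g"] A(2) by linarith
qed

lemma covering_number_translate:
  assumes "compact K" "open V" "V \<noteq> {}"
  shows "covering_number V ((+) g ` K) = covering_number V K"
proof (rule antisym)
  have "(+) (- g) ` (+) g ` K = K"
    by (simp add: translate_translate)
  then show "covering_number V K \<le> covering_number V ((+) g ` K)"
    using covering_number_translate_le[of "(+) g ` K" V "- g"] compact_translate assms by metis
qed (rule covering_number_translate_le[OF assms])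

lemma covering_number_Un_eq:
  assumes "compact K" "compact L" "open V" "V \<noteq> {}"
    and disj: "\<And>a. (+) a ` V \<inter> K = {} \<or> (+) a ` V \<inter> L = {}"
  shows "covering_number V (K \<union> L) = covering_number V K + covering_number V L"
proof (rule antisym[OF covering_number_Un_le[OF assms(1-4)]])
  obtain C where C: "finite C" "card C = covering_number V (K \<union> L)"
      "K \<union> L \<subseteq> (\<Union>a\<in>C. (+) a ` V)"
    using covering_number_witness[OF compact_Un[OF assms(1,2)] assms(3,4)] .
  define A where "A = {a \<in> C. (+) a ` V \<inter> K \<noteq> {}}"
  define B where "B = {a \<in> C. (+) a ` V \<inter> L \<noteq> {}}"
  have fin: "finite A" "finite B"
    using C(1) by (auto simp: A_def B_def)
  have "K \<subseteq> (\<Union>a\<in>A. (+) a ` V)" "L \<subseteq> (\<Union>a\<in>B. (+) a ` V)"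
    using C(3) by (fastforce simp: A_def B_def)+
  then have "covering_number V K + covering_number V L \<le> card A + card B"
    using covering_number_le fin by (metis add_mono)
  also have "\<dots> = card (A \<union> B)"
    using disj by (intro card_Un_disjoint[symmetric] fin) (auto simp: A_def B_def)
  also have "\<dots> \<le> card C"
    using C(1) by (intro card_mono) (auto simp: A_def B_def)
  finally show "covering_number V K + covering_number V L \<le> covering_number V (K \<union> L)"
    using C(2) by simp
qed

lemma covering_number_le_mult:
  assumes "compact K" "compact L" "open U" "U \<noteq> {}" "U \<subseteq> L" "open V" "V \<noteq> {}"
  shows "covering_number V K \<le> covering_number U K * covering_number V L"
proof -
  obtain A where A: "finite A" "card A = covering_number U K" "K \<subseteq> (\<Union>a\<in>A. (+) a ` U)"
    using covering_number_witness[OF assms(1,3,4)] .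
  obtain B where B: "finite B" "card B = covering_number V L" "L \<subseteq> (\<Union>a\<in>B. (+) a ` V)"
    using covering_number_witness[OF assms(2,6,7)] .
  define C where "C = (\<lambda>(a, b). a + b) ` (A \<times> B)"
  have "K \<subseteq> (\<Union>c\<in>C. (+) c ` V)"
  proof
    fix x assume "x \<in> K"
    then obtain a u where "a \<in> A" "u \<in> U" "x = a + u"
      using A(3) by blast
    moreover then obtain b v where "b \<in> B" "v \<in> V" "u = b + v"
      using B(3) assms(5) by blast
    ultimately have "x = (a + b) + v" "a + b \<in> C"
      by (auto simp: add.assoc C_def)
    then show "x \<in> (\<Union>c\<in>C. (+) c ` V)"
      using \<open>v \<in> V\<close> by blast
  qed
  then have "covering_number V K \<le> card C"
    using A(1) B(1) by (intro covering_number_le) (auto simp: C_def)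
  also have "\<dots> \<le> card (A \<times> B)"
    unfolding C_def using A(1) B(1) by (intro card_image_le) auto
  finally show ?thesis
    using A(2) B(2) by (simp add: card_cartesian_product)
qed

lemma covering_number_pos:
  assumes "compact K" "open V" "V \<noteq> {}" "K \<noteq> {}"
  shows "covering_number V K > 0"
proof -
  obtain A where A: "finite A" "card A = covering_number V K" "K \<subseteq> (\<Union>a\<in>A. (+) a ` V)"
    using covering_number_witness[OF assms(1-3)] .
  then have "A \<noteq> {}"
    using assms(4) by auto
  then show ?thesis
    using A by (metis card_gt_0_iff)
qed

lemma exists_haar_content:
  fixes K0 U0 :: "'a::topological_group_add set"
  assumes K0: "compact K0" and U0: "open U0" "0 \<in> U0" "U0 \<subseteq> K0"
  obtains c :: "'a set \<Rightarrow> real" where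
    "\<And>K. compact K \<Longrightarrow> 0 \<le> c K"
    "\<And>K L. compact L \<Longrightarrow> compact K \<Longrightarrow> K \<subseteq> L \<Longrightarrow> c K \<le> c L"
    "\<And>K L. compact K \<Longrightarrow> compact L \<Longrightarrow> c (K \<union> L) \<le> c K + c L"
    "\<And>K L. compact K \<Longrightarrow> compact L \<Longrightarrow> closed L \<Longrightarrow> K \<inter> L = {} \<Longrightarrow> c (K \<union> L) = c K + c L"
    "\<And>K g. compact K \<Longrightarrow> c ((+) g ` K) = c K"
    "c K0 = 1"
proof -
  define h :: "'a set \<Rightarrow> 'a set \<Rightarrow> real" where
    "h V K = (if compact K then covering_number V K / covering_number V K0 else 0)" for V K
  define B where "B = {W :: 'a set. open W \<and> 0 \<in> W}"
  define F where "F = (INF W\<in>B. principal {h V | V. V \<in> B \<and> V \<subseteq> W})"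
  have B_Int: "W \<inter> W' \<in> B" if "W \<in> B" "W' \<in> B" for W W'
    using that by (auto simp: B_def)
  have B_UNIV: "UNIV \<in> B"
    by (auto simp: B_def)
  have ev: "eventually P F \<longleftrightarrow> (\<exists>W\<in>B. \<forall>V\<in>B. V \<subseteq> W \<longrightarrow> P (h V))" for P
    unfolding F_def
  proof (subst eventually_INF_base)
    show "B \<noteq> {}"
      using B_UNIV by auto
    show "\<exists>x\<in>B. principal {h V |V. V \<in> B \<and> V \<subseteq> x}
          \<le> inf (principal {h V |V. V \<in> B \<and> V \<subseteq> a}) (principal {h V |V. V \<in> B \<and> V \<subseteq> b})"
      if "a \<in> B" "b \<in> B" for a b
      using B_Int[OF that] by (intro bexI[of _ "a \<inter> b"]) auto
  qed (auto simp: eventually_principal)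
  have K0_ne: "K0 \<noteq> {}"
    using U0 by auto
  have pos: "covering_number V K0 > 0" if "V \<in> B" for V
    using that by (intro covering_number_pos K0 K0_ne) (auto simp: B_def)
  define S where "S = PiE UNIV (\<lambda>K::'a set. {0..real (covering_number U0 K)})"
  have h_in_S: "h V \<in> S" if "V \<in> B" for V
  proof -
    have "h V K \<in> {0..real (covering_number U0 K)}" for K
    proof (cases "compact K")
      case True
      have "covering_number V K \<le> covering_number U0 K * covering_number V K0"
        using that U0 by (intro covering_number_le_mult True K0) (auto simp: B_def)
      then have "real (covering_number V K) \<le> real (covering_number U0 K) * real (covering_number V K0)"
        by (metis of_nat_le_iff of_nat_mult)
      then show ?thesis
        using True pos[OF that] by (simp add: h_def divide_le_eq)
    qed (simp add: h_def)
    then show ?thesis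
      unfolding S_def by blast
  qed
  have "compactin (product_topology (\<lambda>_. euclidean) UNIV) S"
    unfolding S_def compactin_PiE by auto
  then have "compact S"
    by (simp add: euclidean_product_topology)
  moreover have "eventually (\<lambda>x. x \<in> S) F"
    unfolding ev using B_UNIV by (rule rev_bexI) (simp add: h_in_S)
  moreover have "F \<noteq> bot"
    unfolding trivial_limit_def ev by blast
  ultimately obtain c where c: "c \<in> S" "inf (nhds c) F \<noteq> bot"
    unfolding compact_filter by meson
  define G where "G = inf (nhds c) F"
  have G: "G \<noteq> bot"
    using c by (simp add: G_def)
  have evG: "eventually P G" if "W \<in> B" "\<forall>V\<in>B. V \<subseteq> W \<longrightarrow> P (h V)" for P W
  proof -
    have "eventually P F"
      unfolding ev using that by (rule rev_bexI)
    then show ?thesis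
      unfolding G_def by (rule filter_leD[OF inf_le2])
  qed
  have tend: "((\<lambda>f. f K) \<longlongrightarrow> c K) G" for K
  proof -
    have "((\<lambda>f. f K) \<longlongrightarrow> c K) (nhds c)"
    proof (rule topological_tendstoI)
      fix U :: "real set" assume "open U" "c K \<in> U"
      moreover from this have "open ((\<lambda>f::'a set \<Rightarrow> real. f K) -` U)"
        by (intro open_vimage continuous_on_product_coordinates)
      ultimately show "eventually (\<lambda>f. f K \<in> U) (nhds c)"
        unfolding eventually_nhds by (intro exI[of _ "(\<lambda>f. f K) -` U"]) auto
    qed
    then show ?thesis
      unfolding G_def by (rule tendsto_mono[OF inf_le1])
  qed
  have B_D: "open V" "V \<noteq> {}" if "V \<in> B" for V
    using that by (auto simp: B_def)
  show thesis
  proof (rule that[of c])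
    fix K :: "'a set" assume K: "compact K"
    show "0 \<le> c K"
      using c(1) by (auto simp: S_def PiE_iff)
    fix g
    have "h V ((+) g ` K) = h V K" if "V \<in> B" for V
      unfolding h_def covering_number_translate[OF K B_D[OF that]]
      using K compact_translate[OF K, of g] by simp
    then have "eventually (\<lambda>f. f ((+) g ` K) = f K) G"
      by (intro evG[OF B_UNIV]) simp
    from Lim_transform_eventually[OF tend this] have "((\<lambda>f. f K) \<longlongrightarrow> c ((+) g ` K)) G" .
    then show "c ((+) g ` K) = c K"
      by (rule tendsto_unique[OF G _ tend])
  next
    fix K L :: "'a set" assume *: "compact L" "compact K" "K \<subseteq> L"
    have "h V K \<le> h V L" if "V \<in> B" for V
      unfolding h_def
      using * covering_number_mono[OF *(1) B_D[OF that] *(3)] by (simp add: divide_right_mono)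
    then have "eventually (\<lambda>f. f K \<le> f L) G"
      by (intro evG[OF B_UNIV]) simp
    then show "c K \<le> c L"
      by (rule tendsto_le[OF G tend tend])
  next
    fix K L :: "'a set" assume *: "compact K" "compact L"
    have "h V (K \<union> L) \<le> h V K + h V L" if "V \<in> B" for V
    proof -
      have "real (covering_number V (K \<union> L)) \<le> real (covering_number V K) + real (covering_number V L)"
        using covering_number_Un_le[OF * B_D[OF that]] by linarith
      then show ?thesis
        using * by (simp add: h_def compact_Un divide_right_mono flip: add_divide_distrib)
    qed
    then have "eventually (\<lambda>f. f (K \<union> L) \<le> f K + f L) G"
      by (intro evG[OF B_UNIV]) simp
    then show "c (K \<union> L) \<le> c K + c L"
      by (rule tendsto_le[OF G tendsto_add[OF tend tend] tend])
  next
    fix K L :: "'a set" assume *: "compact K" "compact L" "closed L" "K \<inter> L = {}"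
    obtain V where V: "open V" "0 \<in> V"
      "\<And>x y v w. x \<in> K \<Longrightarrow> y \<in> L \<Longrightarrow> v \<in> V \<Longrightarrow> w \<in> V \<Longrightarrow> x + v \<noteq> y + w"
      using disjoint_compact_add_nbhd[OF *(1,3,4)] by metis
    define W where "W = uminus -` V"
    have W: "W \<in> B"
      using V by (auto simp: W_def B_def intro!: open_vimage continuous_intros)
    have "h V' (K \<union> L) = h V' K + h V' L" if "V' \<in> B" "V' \<subseteq> W" for V'
    proof -
      have "(+) a ` V' \<inter> K = {} \<or> (+) a ` V' \<inter> L = {}" for a
      proof (rule ccontr)
        assume "\<not> ?thesis"
        then obtain v w where vw: "v \<in> V'" "w \<in> V'" "a + v \<in> K" "a + w \<in> L"
          by auto
        then have "- v \<in> V" "- w \<in> V"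
          using that by (auto simp: W_def)
        from V(3)[OF vw(3,4) this] show False
          by (simp add: add.assoc)
      qed
      then have "covering_number V' (K \<union> L) = covering_number V' K + covering_number V' L"
        by (intro covering_number_Un_eq * B_D[OF that(1)])
      then show ?thesis
        using * by (simp add: h_def compact_Un add_divide_distrib)
    qed
    then have "eventually (\<lambda>f. f (K \<union> L) = f K + f L) G"
      by (intro evG[OF W]) simp
    from Lim_transform_eventually[OF tend this]
    show "c (K \<union> L) = c K + c L"
      by (rule tendsto_unique[OF G _ tendsto_add[OF tend tend]])
  next
    have "eventually (\<lambda>f. f K0 = 1) G"
      using pos by (intro evG[OF B_UNIV]) (auto simp: h_def K0)
    from Lim_transform_eventually[OF tend this]
    show "c K0 = 1"
      by (rule tendsto_unique[OF G _ tendsto_const])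
  qed
qed

section \<open>Measures from contents on compact sets\<close>

lemma Hausdorff_compact_imp_closed:
  assumes "Hausdorff_space (euclidean :: 'a::topological_space topology)" "compact (K :: 'a set)"
  shows "closed K"
  using compactin_imp_closedin[OF assms(1), of K] assms(2) by simp

lemma Hausdorff_compact_split:
  fixes K :: "'a::topological_space set"
  assumes haus: "Hausdorff_space (euclidean :: 'a topology)"
    and K: "compact K" "open U" "open V" "K \<subseteq> U \<union> V"
  obtains K1 K2 where "compact K1" "compact K2" "K1 \<subseteq> U" "K2 \<subseteq> V" "K = K1 \<union> K2"
proof -
  have "compact (K - U)" "compact (K - V)" "disjnt (K - U) (K - V)"
    using K by (auto simp: disjnt_def intro: compact_diff)
  then obtain P Q where PQ: "open P" "open Q" "K - U \<subseteq> P" "K - V \<subseteq> Q" "disjnt P Q"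
    using Hausdorff_space_compact_separation[OF haus, of "K - U" "K - V"] by auto
  show thesis
  proof (rule that[of "K - P" "K - Q"])
    show "compact (K - P)" "compact (K - Q)"
      using K(1) PQ(1,2) by (auto intro: compact_diff)
  qed (use PQ in \<open>auto simp: disjnt_iff\<close>)
qed

lemma content_le_sum_open:
  fixes c :: "'a::topological_space set \<Rightarrow> real" and U :: "nat \<Rightarrow> 'a set"
  assumes haus: "Hausdorff_space (euclidean :: 'a topology)"
    and nonneg: "\<And>K. compact K \<Longrightarrow> 0 \<le> c K" and zero: "c {} = 0"
    and subadd: "\<And>K L. compact K \<Longrightarrow> compact L \<Longrightarrow> c (K \<union> L) \<le> c K + c L"
    and U: "\<And>n. open (U n)" and K: "compact K" "K \<subseteq> (\<Union>n<N. U n)"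
  shows "ennreal (c K) \<le> (\<Sum>n<N. SUP L\<in>{L. compact L \<and> L \<subseteq> U n}. ennreal (c L))"
  using K
proof (induction N arbitrary: K)
  case 0
  then show ?case
    by (simp add: zero)
next
  case (Suc N)
  have "K \<subseteq> (\<Union>n<N. U n) \<union> U N"
    using Suc.prems(2) by (simp add: lessThan_Suc Un_commute)
  then obtain K1 K2 where *: "compact K1" "compact K2" "K1 \<subseteq> (\<Union>n<N. U n)" "K2 \<subseteq> U N" "K = K1 \<union> K2"
    using Hausdorff_compact_split[OF haus Suc.prems(1)] U by (metis open_UN)
  have "ennreal (c K) \<le> ennreal (c K1) + ennreal (c K2)"
    using subadd[OF *(1,2)] nonneg[OF *(1)] nonneg[OF *(2)] *(5)
    by (simp flip: ennreal_plus add: ennreal_leI)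
  also have "ennreal (c K2) \<le> (SUP L\<in>{L. compact L \<and> L \<subseteq> U N}. ennreal (c L))"
    using * by (intro SUP_upper) auto
  finally show ?case
    using Suc.IH[OF *(1,3)] by (simp add: add_mono order_trans)
qed

proposition exists_measure_of_content:
  fixes c :: "'a::topological_space set \<Rightarrow> real"
  assumes haus: "Hausdorff_space (euclidean :: 'a topology)"
    and nonneg: "\<And>K. compact K \<Longrightarrow> 0 \<le> c K"
    and mono: "\<And>K L. compact L \<Longrightarrow> compact K \<Longrightarrow> K \<subseteq> L \<Longrightarrow> c K \<le> c L"
    and subadd: "\<And>K L. compact K \<Longrightarrow> compact L \<Longrightarrow> c (K \<union> L) \<le> c K + c L"
    and additive: "\<And>K L. compact K \<Longrightarrow> compact L \<Longrightarrow> K \<inter> L = {} \<Longrightarrow> c (K \<union> L) = c K + c L"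
  obtains M :: "'a measure" where "sets M = sets borel"
    "\<And>U. open U \<Longrightarrow> emeasure M U = (SUP K\<in>{K. compact K \<and> K \<subseteq> U}. ennreal (c K))"
    "\<And>A. A \<in> sets borel \<Longrightarrow> emeasure M A = (INF U\<in>{U. open U \<and> A \<subseteq> U}. emeasure M U)"
proof -
  define \<mu>o where "\<mu>o U = (SUP K\<in>{K. compact K \<and> K \<subseteq> U}. ennreal (c K))" for U :: "'a set"
  define \<mu> where "\<mu> A = (INF U\<in>{U. open U \<and> A \<subseteq> U}. \<mu>o U)" for A :: "'a set"
  have zero: "c {} = 0"
    using additive[of "{}" "{}"] by simp
  have \<mu>o_upper: "ennreal (c K) \<le> \<mu>o U" if "compact K" "K \<subseteq> U" for K U
    unfolding \<mu>o_def using that by (intro SUP_upper) auto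
  have \<mu>o_mono: "\<mu>o U \<le> \<mu>o V" if "U \<subseteq> V" for U V
    unfolding \<mu>o_def using that by (intro SUP_subset_mono) auto
  have \<mu>_lower: "\<mu> A \<le> \<mu>o U" if "open U" "A \<subseteq> U" for A U
    unfolding \<mu>_def using that by (intro INF_lower) auto
  have \<mu>_mono: "\<mu> A \<le> \<mu> B" if "A \<subseteq> B" for A B
    unfolding \<mu>_def using that by (intro INF_superset_mono) auto
  have \<mu>_open: "\<mu> U = \<mu>o U" if "open U" for U
  proof (rule antisym)
    show "\<mu>o U \<le> \<mu> U"
      unfolding \<mu>_def using \<mu>o_mono by (intro INF_greatest) auto
  qed (use that in \<open>auto intro: \<mu>_lower\<close>)
  have \<mu>o_empty: "\<mu>o {} = 0"
    by (simp add: \<mu>o_def zero)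
  have \<mu>o_UN: "\<mu>o (\<Union>n. U n) \<le> (\<Sum>n. \<mu>o (U n))" if op: "\<And>n. open (U n)" for U :: "nat \<Rightarrow> 'a set"
    unfolding \<mu>o_def[of "\<Union>n. U n"]
  proof (rule SUP_least, safe)
    fix K assume K: "compact K" "K \<subseteq> (\<Union>n. U n)"
    obtain C where C: "C \<subseteq> UNIV" "finite C" "K \<subseteq> (\<Union>n\<in>C. U n)"
      using compactE_image[OF K(1), of UNIV U] op K(2) by metis
    obtain N where "C \<subseteq> {..<N}"
      using finite_nat_bounded[OF C(2)] by blast
    then have "K \<subseteq> (\<Union>n<N. U n)"
      using C(3) by blast
    then have "ennreal (c K) \<le> (\<Sum>n<N. \<mu>o (U n))"
      unfolding \<mu>o_def by (intro content_le_sum_open haus nonneg zero subadd that K(1))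
    also have "\<dots> \<le> (\<Sum>n. \<mu>o (U n))"
      by (intro sum_le_suminf) auto
    finally show "ennreal (c K) \<le> (\<Sum>n. \<mu>o (U n))" .
  qed
  have subadditive: "\<mu> (\<Union>n. A n) \<le> (\<Sum>n. \<mu> (A n))" for A :: "nat \<Rightarrow> 'a set"
  proof (rule ennreal_le_epsilon)
    fix e :: real assume e: "0 < e" and fin: "(\<Sum>n. \<mu> (A n)) < top"
    have "\<exists>U. open U \<and> A n \<subseteq> U \<and> \<mu>o U \<le> \<mu> (A n) + e * (1/2) ^ Suc n" for n
    proof -
      have "\<mu> (A n) < \<mu> (A n) + e * (1/2) ^ Suc n"
        using e ennreal_suminf_lessD[OF fin, of n] by (auto simp: less_top)
      then show ?thesis
        unfolding \<mu>_def INF_less_iff by (auto intro: less_imp_le)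
    qed
    then obtain U where U: "\<And>n. open (U n)" "\<And>n. A n \<subseteq> U n"
        "\<And>n. \<mu>o (U n) \<le> \<mu> (A n) + e * (1/2) ^ Suc n"
      by metis
    have "\<mu> (\<Union>n. A n) \<le> \<mu>o (\<Union>n. U n)"
      using U by (intro \<mu>_lower) auto
    also have "\<dots> \<le> (\<Sum>n. \<mu>o (U n))"
      by (rule \<mu>o_UN[OF U(1)])
    also have "\<dots> \<le> (\<Sum>n. \<mu> (A n) + e * (1/2) ^ Suc n)"
      by (intro suminf_le U(3)) auto
    also have "\<dots> = (\<Sum>n. \<mu> (A n)) + (\<Sum>n. ennreal e * ennreal ((1/2) ^ Suc n))"
      using e by (subst suminf_add[symmetric])
        (auto simp del: ennreal_suminf_cmult simp add: ennreal_mult[symmetric])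
    also have "\<dots> = (\<Sum>n. \<mu> (A n)) + e"
      unfolding ennreal_suminf_cmult
      by (subst suminf_ennreal_eq[OF zero_le_power power_half_series]) auto
    finally show "\<mu> (\<Union>n. A n) \<le> (\<Sum>n. \<mu> (A n)) + e" .
  qed
  have outer: "outer_measure_space (Pow UNIV) \<mu>"
    unfolding outer_measure_space_def positive_def increasing_def countably_subadditive_def
    using \<mu>_open[of "{}"] \<mu>o_empty \<mu>_mono subadditive by auto
  define \<L> where "\<L> = lambda_system UNIV (Pow UNIV) \<mu>"
  interpret P: sigma_algebra UNIV "Pow (UNIV :: 'a set)"
    by (rule sigma_algebra_Pow)
  have \<L>: "measure_space UNIV \<L> \<mu>"
    unfolding \<L>_def by (rule P.caratheodory_lemma[OF outer])
  have open_split: "\<mu>o (W \<inter> U) + \<mu> (W - U) \<le> \<mu>o W" if "open U" "open W" for U W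
  proof -
    have *: "ennreal (c K) + \<mu> (W - U) \<le> \<mu>o W" if "compact K" "K \<subseteq> W \<inter> U" for K
    proof -
      have K: "closed K"
        using Hausdorff_compact_imp_closed[OF haus that(1)] .
      have "ennreal (c L) + ennreal (c K) \<le> \<mu>o W" if "compact L" "L \<subseteq> W - K" for L
      proof -
        have "L \<inter> K = {}"
          using that(2) by auto
        then have "ennreal (c L) + ennreal (c K) = ennreal (c (L \<union> K))"
          using that \<open>compact K\<close> additive[of L K] nonneg[of K] nonneg[of L] by simp
        also have "\<dots> \<le> \<mu>o W"
          using that \<open>compact K\<close> \<open>K \<subseteq> W \<inter> U\<close> by (intro \<mu>o_upper) auto
        finally show ?thesis .
      qed
      moreover have "{L. compact L \<and> L \<subseteq> W - K} \<noteq> {}"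
        by auto
      ultimately have "\<mu>o (W - K) + ennreal (c K) \<le> \<mu>o W"
        unfolding \<mu>o_def[of "W - K"]
        by (subst ennreal_SUP_add_left[symmetric]) (auto intro!: SUP_least)
      moreover have "\<mu> (W - U) \<le> \<mu>o (W - K)"
        using \<open>open W\<close> K that by (intro \<mu>_lower open_Diff) auto
      ultimately show ?thesis
        by (metis add.commute add_left_mono order_trans)
    qed
    have ne: "{K. compact K \<and> K \<subseteq> W \<inter> U} \<noteq> {}"
      by auto
    show ?thesis
      unfolding \<mu>o_def[of "W \<inter> U"]
      using * ne by (subst ennreal_SUP_add_left[symmetric]) (auto intro!: SUP_least)
  qed
  have "open U \<Longrightarrow> U \<in> \<L>" for U
    unfolding \<L>_def P.lambda_system_eq
  proof (simp, intro allI antisym)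
    fix A assume U: "open U"
    show "\<mu> (A \<inter> U) + \<mu> (A - U) \<le> \<mu> A"
      unfolding \<mu>_def[of A]
    proof (rule INF_greatest, safe)
      fix W assume W: "open W" "A \<subseteq> W"
      have "\<mu> (A \<inter> U) + \<mu> (A - U) \<le> \<mu>o (W \<inter> U) + \<mu> (W - U)"
        using W U by (intro add_mono \<mu>_lower \<mu>_mono) auto
      also have "\<dots> \<le> \<mu>o W"
        by (rule open_split[OF U W(1)])
      finally show "\<mu> (A \<inter> U) + \<mu> (A - U) \<le> \<mu>o W" .
    qed
    show "\<mu> A \<le> \<mu> (A \<inter> U) + \<mu> (A - U)"
    proof -
      define B where "B n = (if n = (0::nat) then A \<inter> U else if n = 1 then A - U else {})" for n
      have "(\<Union>n. B n) = A"
        by (auto simp: B_def split: if_splits)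
      moreover have "(\<Sum>n. \<mu> (B n)) = (\<Sum>n\<in>{0, 1}. \<mu> (B n))"
        using \<mu>_open[of "{}"] \<mu>o_empty by (intro suminf_finite) (auto simp: B_def)
      ultimately show ?thesis
        using subadditive[of B] by (simp add: B_def)
    qed
  qed
  then have "sigma_sets UNIV {U. open U} \<subseteq> \<L>"
    using \<L> by (intro sigma_algebra.sigma_sets_subset) (auto simp: measure_space_def)
  then have borel: "measure_space UNIV (sets borel) \<mu>"
    using measure_down[OF \<L>] sets.sigma_algebra_axioms[of "borel :: 'a measure"]
    by (simp add: borel_def)
  define M where "M = measure_of UNIV (sets (borel :: 'a measure)) \<mu>"
  have sets: "sets M = sets borel"
    unfolding M_def using sets.sigma_sets_eq[of "borel :: 'a measure"] by simp
  have emeasure: "emeasure M A = \<mu> A" if "A \<in> sets borel" for A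
    unfolding M_def using borel that by (intro emeasure_measure_of_sigma) (auto simp: measure_space_def)
  show thesis
  proof (rule that[OF sets])
    show "emeasure M U = (SUP K\<in>{K. compact K \<and> K \<subseteq> U}. ennreal (c K))" if "open U" for U
      using that \<mu>_open[OF that] by (simp add: emeasure \<mu>o_def)
    show "emeasure M A = (INF U\<in>{U. open U \<and> A \<subseteq> U}. emeasure M U)" if "A \<in> sets borel" for A
      using that \<mu>_open by (simp add: emeasure \<mu>_def cong: INF_cong_simp)
  qed
qed

section \<open>Haar measure\<close>

theorem exists_left_haar_measure:
  assumes haus: "Hausdorff_space (euclidean :: 'a::topological_group_add topology)"
    and lc: "locally_compact_space (euclidean :: 'a::topological_group_add topology)"
  obtains M :: "'a::topological_group_add measure" where "sets M = sets borel"
    "\<And>K. compact K \<Longrightarrow> emeasure M K < \<infinity>"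
    "\<And>A. A \<in> sets borel \<Longrightarrow> emeasure M A = (INF U\<in>{U. open U \<and> A \<subseteq> U}. emeasure M U)"
    "\<And>U. open U \<Longrightarrow> emeasure M U = (SUP K\<in>{K. compact K \<and> K \<subseteq> U}. emeasure M K)"
    "\<And>U. open U \<Longrightarrow> U \<noteq> {} \<Longrightarrow> emeasure M U \<noteq> 0"
    "\<And>a. distr M borel ((+) a) = M"
proof -
  have closed: "closed K" if "compact K" for K :: "'a set"
    using Hausdorff_compact_imp_closed[OF haus that] .
  obtain U0 K0 :: "'a set" where U0: "open U0" "0 \<in> U0" "U0 \<subseteq> K0" and K0: "compact K0"
    using lc[unfolded locally_compact_space_def, rule_format, of 0] by auto
  obtain c :: "'a set \<Rightarrow> real" where c:
    "\<And>K. compact K \<Longrightarrow> 0 \<le> c K"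
    "\<And>K L. compact L \<Longrightarrow> compact K \<Longrightarrow> K \<subseteq> L \<Longrightarrow> c K \<le> c L"
    "\<And>K L. compact K \<Longrightarrow> compact L \<Longrightarrow> c (K \<union> L) \<le> c K + c L"
    "\<And>K L. compact K \<Longrightarrow> compact L \<Longrightarrow> closed L \<Longrightarrow> K \<inter> L = {} \<Longrightarrow> c (K \<union> L) = c K + c L"
    and c_translate: "\<And>K g. compact K \<Longrightarrow> c ((+) g ` K) = c K"
    and c_K0: "c K0 = 1"
    using exists_haar_content[OF K0 U0] by blast
  obtain M :: "'a measure" where sets: "sets M = sets borel"
    and M_open: "\<And>U. open U \<Longrightarrow> emeasure M U = (SUP K\<in>{K. compact K \<and> K \<subseteq> U}. ennreal (c K))"
    and M_outer: "\<And>A. A \<in> sets borel \<Longrightarrow> emeasure M A = (INF U\<in>{U. open U \<and> A \<subseteq> U}. emeasure M U)"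
    using exists_measure_of_content[OF haus c(1-3) c(4)[OF _ _ closed]] by blast
  have c_le_M: "ennreal (c K) \<le> emeasure M K" if "compact K" for K
  proof -
    have "K \<in> sets borel"
      using closed[OF that] by (rule borel_closed)
    moreover have "ennreal (c K) \<le> emeasure M U" if "open U" "K \<subseteq> U" for U
      unfolding M_open[OF \<open>open U\<close>] using \<open>compact K\<close> that by (intro SUP_upper) auto
    ultimately show ?thesis
      by (subst M_outer) (auto intro: INF_greatest)
  qed
  have translate_borel: "(+) a ` A \<in> sets borel" if "A \<in> sets borel" for a and A :: "'a set"
  proof -
    have "(\<lambda>x. - a + x) \<in> borel_measurable borel"
      by (intro borel_measurable_continuous_onI continuous_intros)
    from measurable_sets[OF this that] show ?thesis
      by (simp add: translate_eq_vimage)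
  qed
  have translate_open_le: "emeasure M ((+) a ` U) \<le> emeasure M U" if "open U" for a U
    unfolding M_open[OF that] M_open[OF open_translate[OF that]]
  proof (rule SUP_least, clarify)
    fix K assume K: "compact K" "K \<subseteq> (+) a ` U"
    have "(+) (- a) ` K \<subseteq> U"
      using K(2) by (auto simp: mem_translate_iff)
    moreover have "c K = c ((+) (- a) ` K)"
      using c_translate[OF K(1)] by simp
    ultimately show "ennreal (c K) \<le> (SUP K\<in>{K. compact K \<and> K \<subseteq> U}. ennreal (c K))"
      using compact_translate[OF K(1)] by (intro SUP_upper2[of "(+) (- a) ` K"]) auto
  qed
  have translate_le: "emeasure M ((+) a ` A) \<le> emeasure M A" if A: "A \<in> sets borel" for a A
    unfolding M_outer[OF A]
  proof (rule INF_greatest, clarify)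
    fix U assume U: "open U" "A \<subseteq> U"
    have "emeasure M ((+) a ` A) \<le> emeasure M ((+) a ` U)"
      using U open_translate[OF U(1)] by (intro emeasure_mono) (auto simp: sets)
    also have "\<dots> \<le> emeasure M U"
      by (rule translate_open_le[OF U(1)])
    finally show "emeasure M ((+) a ` A) \<le> emeasure M U" .
  qed
  have translate: "emeasure M ((+) a ` A) = emeasure M A" if A: "A \<in> sets borel" for a A
  proof (rule antisym[OF translate_le[OF A]])
    show "emeasure M A \<le> emeasure M ((+) a ` A)"
      using translate_le[OF translate_borel[OF A], of "- a" a]
      unfolding translate_translate by simp
  qed
  have cover_le: "emeasure M K \<le> of_nat (card A) * emeasure M U"
    if "finite A" "compact K" "open U" "K \<subseteq> (\<Union>a\<in>A. (+) a ` U)" for A K U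
  proof -
    have "emeasure M K \<le> emeasure M (\<Union>a\<in>A. (+) a ` U)"
      using that open_translate[OF that(3)] by (intro emeasure_mono) (auto simp: sets)
    also have "\<dots> \<le> (\<Sum>a\<in>A. emeasure M ((+) a ` U))"
      using that open_translate[OF that(3)] by (intro emeasure_subadditive_finite) (auto simp: sets)
    also have "\<dots> = of_nat (card A) * emeasure M U"
      using translate that(3) by simp
    finally show ?thesis .
  qed
  show thesis
  proof (rule that[OF sets _ M_outer])
    fix K :: "'a set" assume K: "compact K"
    obtain A where A: "finite A" "K \<subseteq> (\<Union>a\<in>A. (+) a ` U0)"
      using finite_translates_cover[OF K U0(1)] U0(2) by blast
    have M_U0: "emeasure M U0 \<le> 1"
      unfolding M_open[OF U0(1)]
    proof (rule SUP_least, clarify)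
      fix L assume "compact L" "L \<subseteq> U0"
      then have "c L \<le> c K0"
        using c(2)[OF K0, of L] U0(3) by auto
      then show "ennreal (c L) \<le> 1"
        by (simp add: c_K0)
    qed
    have "emeasure M K \<le> of_nat (card A) * emeasure M U0"
      by (rule cover_le[OF A(1) K U0(1) A(2)])
    also have "\<dots> \<le> of_nat (card A) * 1"
      using M_U0 by (intro mult_left_mono) auto
    also have "\<dots> < \<infinity>"
      by (simp add: of_nat_less_top)
    finally show "emeasure M K < \<infinity>" .
  next
    fix U :: "'a set" assume U: "open U"
    show "emeasure M U = (SUP K\<in>{K. compact K \<and> K \<subseteq> U}. emeasure M K)"
    proof (rule antisym)
      show "emeasure M U \<le> (SUP K\<in>{K. compact K \<and> K \<subseteq> U}. emeasure M K)"
        unfolding M_open[OF U] using c_le_M by (intro SUP_mono) auto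
      show "(SUP K\<in>{K. compact K \<and> K \<subseteq> U}. emeasure M K) \<le> emeasure M U"
        using U by (intro SUP_least emeasure_mono) (auto simp: sets)
    qed
    assume ne: "U \<noteq> {}"
    obtain A where A: "finite A" "K0 \<subseteq> (\<Union>a\<in>A. (+) a ` U)"
      using finite_translates_cover[OF K0 U ne] by blast
    have "1 \<le> of_nat (card A) * emeasure M U"
      using c_le_M[OF K0] cover_le[OF A(1) K0 U A(2)] by (simp add: c_K0)
    then show "emeasure M U \<noteq> 0"
      by auto
  next
    fix a :: 'a
    have meas: "(+) a \<in> measurable M borel"
      unfolding measurable_cong_sets[OF sets refl]
      by (intro borel_measurable_continuous_onI continuous_intros)
    show "distr M borel ((+) a) = M"
    proof (rule measure_eqI)
      fix A assume "A \<in> sets (distr M borel ((+) a))"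
      then have A: "A \<in> sets borel"
        by simp
      have "emeasure (distr M borel ((+) a)) A = emeasure M ((+) a -` A)"
        using sets_eq_imp_space_eq[OF sets] by (simp add: emeasure_distr[OF meas A])
      also have "(+) a -` A = (+) (- a) ` A"
        by (simp add: translate_eq_vimage)
      finally show "emeasure (distr M borel ((+) a)) A = emeasure M A"
        using translate[OF A] by simp
    qed (simp add: sets)
  qed
qed

section \<open>The group of paths\<close>

lemma homotopic_paths_add:
  fixes p :: "real \<Rightarrow> 'a::topological_group_add"
  assumes "homotopic_paths UNIV p p'" "homotopic_paths UNIV q q'"
  shows "homotopic_paths UNIV (\<lambda>t. p t + q t) (\<lambda>t. p' t + q' t)"
proof -
  obtain h where h: "continuous_on ({0..1} \<times> {0..1}) h"
      "\<forall>x\<in>{0..1}. h (0, x) = p x" "\<forall>x\<in>{0..1}. h (1, x) = p' x"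
      "\<forall>t\<in>{0..1::real}. pathstart (h \<circ> Pair t) = pathstart p \<and> pathfinish (h \<circ> Pair t) = pathfinish p"
    using assms(1) unfolding homotopic_paths by blast
  obtain k where k: "continuous_on ({0..1} \<times> {0..1}) k"
      "\<forall>x\<in>{0..1}. k (0, x) = q x" "\<forall>x\<in>{0..1}. k (1, x) = q' x"
      "\<forall>t\<in>{0..1::real}. pathstart (k \<circ> Pair t) = pathstart q \<and> pathfinish (k \<circ> Pair t) = pathfinish q"
    using assms(2) unfolding homotopic_paths by blast
  show ?thesis
    unfolding homotopic_paths
    by (intro exI[of _ "\<lambda>z. h z + k z"] conjI continuous_on_add h(1) k(1))
       (use h k in \<open>auto simp: pathstart_def pathfinish_def\<close>)
qed

lemma homotopic_paths_uminus:
  fixes p :: "real \<Rightarrow> 'a::topological_group_add"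
  assumes "homotopic_paths UNIV p p'"
  shows "homotopic_paths UNIV (\<lambda>t. - p t) (\<lambda>t. - p' t)"
proof -
  obtain h where h: "continuous_on ({0..1} \<times> {0..1}) h"
      "\<forall>x\<in>{0..1}. h (0, x) = p x" "\<forall>x\<in>{0..1}. h (1, x) = p' x"
      "\<forall>t\<in>{0..1::real}. pathstart (h \<circ> Pair t) = pathstart p \<and> pathfinish (h \<circ> Pair t) = pathfinish p"
    using assms unfolding homotopic_paths by blast
  show ?thesis
    unfolding homotopic_paths
    by (intro exI[of _ "\<lambda>z. - h z"] conjI continuous_on_minus h(1))
       (use h in \<open>auto simp: pathstart_def pathfinish_def\<close>)
qed

lemma path_add:
  "path p \<Longrightarrow> path q \<Longrightarrow> path (\<lambda>t. p t + q t :: 'a::topological_group_add)"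
  unfolding path_def by (intro continuous_intros)

lemma path_uminus: "path p \<Longrightarrow> path (\<lambda>t. - p t :: 'a::topological_group_add)"
  unfolding path_def by (intro continuous_intros)

lemma path_diff:
  "path p \<Longrightarrow> path q \<Longrightarrow> path (\<lambda>t. p t - q t :: 'a::topological_group_add)"
  unfolding path_def by (intro continuous_intros)

lemma path_const': "path (\<lambda>_. a)"
  unfolding path_def by (rule continuous_on_const)

lemma openin_path_space_maps_into:
  assumes "compact K" "K \<subseteq> {0..1}" "open U"
  shows "openin path_space {p. path p \<and> p ` K \<subseteq> U}"
  unfolding path_space_def using assms by (intro topology_generated_by_Basis) blast

lemma path_space_add_nbhd_maps_into:
  fixes p q :: "real \<Rightarrow> 'a::topological_group_add"
  assumes K: "compact K" "K \<subseteq> {0..1}" and U: "open U"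
    and pq: "path p" "path q" "\<And>t. t \<in> K \<Longrightarrow> p t + q t \<in> U"
  shows "\<exists>A B. openin path_space A \<and> openin path_space B \<and> p \<in> A \<and> q \<in> B \<and>
           (\<forall>p'\<in>A. \<forall>q'\<in>B. \<forall>t\<in>K. p' t + q' t \<in> U)"
proof -
  have "\<exists>A B e. open A \<and> open B \<and> e > 0 \<and> (\<forall>a\<in>A. \<forall>b\<in>B. a + b \<in> U) \<and>
          p ` (K \<inter> cball t e) \<subseteq> A \<and> q ` (K \<inter> cball t e) \<subseteq> B" if t: "t \<in> K" for t
  proof -
    have "open ((\<lambda>z. fst z + snd z) -` U)"
      by (intro open_vimage U continuous_intros)
    moreover have "(p t, q t) \<in> (\<lambda>z. fst z + snd z) -` U"
      using pq(3)[OF t] by simp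
    ultimately obtain A B where AB: "open A" "open B" "(p t, q t) \<in> A \<times> B"
        "A \<times> B \<subseteq> (\<lambda>z. fst z + snd z) -` U"
      by (rule open_prod_elim)
    have "t \<in> {0..1}"
      using t K by auto
    then have "(p \<longlongrightarrow> p t) (at t within {0..1})" "(q \<longlongrightarrow> q t) (at t within {0..1})"
      using pq(1,2) by (auto simp: path_def continuous_on)
    then have "eventually (\<lambda>s. p s \<in> A \<and> q s \<in> B) (at t within {0..1})"
      using AB by (intro eventually_conj topological_tendstoD) auto
    then obtain d where d: "d > 0" "\<forall>s\<in>{0..1}. s \<noteq> t \<and> dist s t < d \<longrightarrow> p s \<in> A \<and> q s \<in> B"
      unfolding eventually_at by blast
    have "p s \<in> A \<and> q s \<in> B" if "s \<in> K" "s \<in> cball t (d / 2)" for s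
    proof (cases "s = t")
      case True
      then show ?thesis
        using AB(3) by auto
    next
      case False
      have "dist s t < d"
        using that(2) d(1) by (simp add: dist_commute)
      then show ?thesis
        using d(2) that(1) K(2) False by blast
    qed
    then show ?thesis
      using AB d(1) by (intro exI[of _ A] exI[of _ B] exI[of _ "d / 2"]) auto
  qed
  then have "\<forall>t\<in>K. \<exists>A B e. open A \<and> open B \<and> e > 0 \<and> (\<forall>a\<in>A. \<forall>b\<in>B. a + b \<in> U) \<and>
          p ` (K \<inter> cball t e) \<subseteq> A \<and> q ` (K \<inter> cball t e) \<subseteq> B"
    by (rule ballI)
  then obtain A B e where "\<forall>t\<in>K. open (A t) \<and> open (B t) \<and> e t > 0 \<and>
      (\<forall>a\<in>A t. \<forall>b\<in>B t. a + b \<in> U) \<and>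
      p ` (K \<inter> cball t (e t)) \<subseteq> A t \<and> q ` (K \<inter> cball t (e t)) \<subseteq> B t"
    unfolding bchoice_iff by blast
  then have ABe: "\<And>t. t \<in> K \<Longrightarrow> open (A t)" "\<And>t. t \<in> K \<Longrightarrow> open (B t)"
      "\<And>t. t \<in> K \<Longrightarrow> e t > 0" "\<And>t a b. t \<in> K \<Longrightarrow> a \<in> A t \<Longrightarrow> b \<in> B t \<Longrightarrow> a + b \<in> U"
      "\<And>t. t \<in> K \<Longrightarrow> p ` (K \<inter> cball t (e t)) \<subseteq> A t"
      "\<And>t. t \<in> K \<Longrightarrow> q ` (K \<inter> cball t (e t)) \<subseteq> B t"
    by simp_all
  have "K \<subseteq> (\<Union>t\<in>K. ball t (e t))"
    using ABe(3) by force
  then obtain T where T: "T \<subseteq> K" "finite T" "K \<subseteq> (\<Union>t\<in>T. ball t (e t))"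
    using compactE_image[OF K(1), of K "\<lambda>t. ball t (e t)"] by blast
  define N where "N C =
      (\<Inter>t\<in>T. {r :: real \<Rightarrow> 'a. path r \<and> r ` (K \<inter> cball t (e t)) \<subseteq> C t}) \<inter> topspace path_space" for C
  have N: "openin path_space (N C)" if "\<And>t. t \<in> K \<Longrightarrow> open (C t)" for C
    unfolding N_def using T(1,2) K that
    by (intro openin_INT openin_path_space_maps_into) (auto intro: compact_Int_closed)
  have "p' t + q' t \<in> U" if "p' \<in> N A" "q' \<in> N B" "t \<in> K" for p' q' t
  proof -
    obtain s where s: "s \<in> T" "t \<in> cball s (e s)"
      using T(3) \<open>t \<in> K\<close> by force
    then have "p' t \<in> A s" "q' t \<in> B s"
      using that unfolding N_def by blast+
    then show ?thesis
      using ABe(4)[of s] s(1) T(1) by blast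
  qed
  moreover have "p \<in> N A" "q \<in> N B"
    unfolding N_def using pq(1,2) ABe(5,6)[OF subsetD[OF T(1)]] by simp_all
  ultimately show ?thesis
    using N[of A] N[of B] ABe(1,2) by blast
qed

lemma path_space_add_nbhd:
  fixes p q :: "real \<Rightarrow> 'a::topological_group_add"
  assumes "openin path_space S" "path p" "path q" "(\<lambda>t. p t + q t) \<in> S"
  shows "\<exists>A B. openin path_space A \<and> openin path_space B \<and> p \<in> A \<and> q \<in> B \<and>
           (\<forall>p'\<in>A. \<forall>q'\<in>B. (\<lambda>t. p' t + q' t) \<in> S)"
proof -
  have "generate_topology_on
      {{p. path p \<and> p ` K \<subseteq> U} | K (U :: 'a set). compact K \<and> K \<subseteq> {0..1} \<and> open U} S"
    using assms(1) unfolding path_space_def by (rule openin_topology_generated_by)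
  then show ?thesis
    using assms(4)
  proof induction
    case Empty
    then show ?case
      by simp
  next
    case (Int S S')
    then obtain A B A' B' where
      "openin path_space A" "openin path_space B" "p \<in> A" "q \<in> B"
      "\<forall>p'\<in>A. \<forall>q'\<in>B. (\<lambda>t. p' t + q' t) \<in> S"
      "openin path_space A'" "openin path_space B'" "p \<in> A'" "q \<in> B'"
      "\<forall>p'\<in>A'. \<forall>q'\<in>B'. (\<lambda>t. p' t + q' t) \<in> S'"
      by blast
    then show ?case
      by (intro exI[of _ "A \<inter> A'"] exI[of _ "B \<inter> B'"]) auto
  next
    case (UN \<K>)
    then obtain S where "S \<in> \<K>" "(\<lambda>t. p t + q t) \<in> S"
      by blast
    with UN.IH[OF this] show ?case
      by blast
  next
    case (Basis S)
    then obtain K and U :: "'a set" where K: "compact K" "K \<subseteq> {0..1}" "open U"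
      and S: "S = {p. path p \<and> p ` K \<subseteq> U}"
      by blast
    have "p t + q t \<in> U" if "t \<in> K" for t
      using Basis.prems that unfolding S by blast
    from path_space_add_nbhd_maps_into[OF K assms(2,3) this]
    obtain A B where AB: "openin path_space A" "openin path_space B" "p \<in> A" "q \<in> B"
      "\<forall>p'\<in>A. \<forall>q'\<in>B. \<forall>t\<in>K. p' t + q' t \<in> U"
      by blast
    moreover have "A \<subseteq> Collect path" "B \<subseteq> Collect path"
      using AB(1,2)[THEN openin_subset] by auto
    ultimately have "(\<lambda>t. p' t + q' t) \<in> S" if "p' \<in> A" "q' \<in> B" for p' q'
      unfolding S using that by (auto intro: path_add)
    then show ?case
      using AB(1-4) by (intro exI[of _ A] exI[of _ B]) simp
  qed
qed

lemma openin_path_space_translate: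
  fixes n :: "real \<Rightarrow> 'a::topological_group_add"
  assumes "openin path_space S" "path n"
  shows "openin path_space {p. path p \<and> (\<lambda>t. p t + n t) \<in> S}"
proof (subst openin_subopen, clarify)
  fix p assume p: "path p" "(\<lambda>t. p t + n t) \<in> S"
  from path_space_add_nbhd[OF assms(1) p(1) assms(2) p(2)]
  obtain A B where AB: "openin path_space A" "p \<in> A" "n \<in> B"
      "\<forall>p'\<in>A. \<forall>q'\<in>B. (\<lambda>t. p' t + q' t) \<in> S"
    by blast
  moreover have "A \<subseteq> Collect path"
    using AB(1)[THEN openin_subset] by simp
  ultimately have "A \<subseteq> {p. path p \<and> (\<lambda>t. p t + n t) \<in> S}"
    by blast
  then show "\<exists>A. openin path_space A \<and> p \<in> A \<and> A \<subseteq> {p. path p \<and> (\<lambda>t. p t + n t) \<in> S}"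
    using AB by blast
qed

lemma continuous_map_path_space_uminus:
  "continuous_map path_space path_space (\<lambda>p t. - p t :: 'a::topological_group_add)"
proof -
  have "continuous_map path_space (topology_generated_by
      {{p. path p \<and> p ` K \<subseteq> U} | K (U :: 'a set). compact K \<and> K \<subseteq> {0..1} \<and> open U})
      (\<lambda>p t. - p t :: 'a)"
  proof (rule continuous_on_generated_topo)
    fix S :: "(real \<Rightarrow> 'a) set"
    assume "S \<in> {{p. path p \<and> p ` K \<subseteq> U} | K (U :: 'a set). compact K \<and> K \<subseteq> {0..1} \<and> open U}"
    then obtain K and U :: "'a set" where K: "compact K" "K \<subseteq> {0..1}" "open U"
      and S: "S = {p. path p \<and> p ` K \<subseteq> U}"
      by blast
    have "(\<lambda>p t. - p t) -` S \<inter> topspace path_space = {p. path p \<and> p ` K \<subseteq> uminus -` U}"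
      unfolding S by (auto intro: path_uminus)
    moreover have "open (uminus -` U)"
      by (intro open_vimage K(3) continuous_intros)
    ultimately show "openin path_space ((\<lambda>p t. - p t) -` S \<inter> topspace path_space)"
      using openin_path_space_maps_into[OF K(1,2)] by simp
  next
    show "(\<lambda>p t. - p t) ` topspace path_space
        \<subseteq> \<Union> {{p. path p \<and> p ` K \<subseteq> U} | K (U :: 'a set). compact K \<and> K \<subseteq> {0..1} \<and> open U}"
      unfolding topology_generated_by_topspace[symmetric] path_space_def[symmetric]
      by (auto intro: path_uminus)
  qed
  then show ?thesis
    by (simp add: path_space_def)
qed

lemma mem_path_class_iff: "q \<in> path_class p \<longleftrightarrow> homotopic_paths UNIV p q"
  by (simp add: path_class_def)

lemma path_class_eq_iff:
  assumes "path p" "path q"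
  shows "path_class p = path_class q \<longleftrightarrow> homotopic_paths UNIV p q"
proof
  assume "path_class p = path_class q"
  moreover have "q \<in> path_class q"
    using assms by (simp add: mem_path_class_iff)
  ultimately show "homotopic_paths UNIV p q"
    by (simp add: mem_path_class_iff flip: \<open>path_class p = path_class q\<close>)
next
  assume *: "homotopic_paths UNIV p q"
  show "path_class p = path_class q"
    unfolding path_class_def
    using homotopic_paths_trans[OF *] homotopic_paths_trans[OF homotopic_paths_sym[OF *]] by blast
qed

typedef (overloaded) 'a path_group =
  "path_class ` Collect path :: (real \<Rightarrow> 'a::topological_space) set set"
  by (intro exI[of _ "path_class (\<lambda>_. undefined)"]) (auto intro: path_const')

lemma range_Rep_path_group: "range Rep_path_group = path_class ` Collect path"
  by (rule type_definition.Rep_range[OF type_definition_path_group])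

definition pclass :: "(real \<Rightarrow> 'a::topological_space) \<Rightarrow> 'a path_group" where
  "pclass p = Abs_path_group (path_class p)"

definition prep :: "'a::topological_space path_group \<Rightarrow> real \<Rightarrow> 'a" where
  "prep x = (SOME p. path p \<and> pclass p = x)"

lemma Rep_pclass: "path p \<Longrightarrow> Rep_path_group (pclass p) = path_class p"
  by (simp add: pclass_def Abs_path_group_inverse)

lemma pclass_eq_iff: "path p \<Longrightarrow> path q \<Longrightarrow> pclass p = pclass q \<longleftrightarrow> homotopic_paths UNIV p q"
  by (metis Rep_pclass path_class_eq_iff Rep_path_group_inject)

lemma pclass_eqI: "homotopic_paths UNIV p q \<Longrightarrow> pclass p = pclass q"
  using pclass_eq_iff homotopic_paths_imp_path by blast

lemma path_group_cases: obtains p where "path p" "x = pclass p"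
proof -
  obtain p where "path p" "Rep_path_group x = path_class p"
    using Rep_path_group[of x] by blast
  then show thesis
    using that by (metis Rep_pclass Rep_path_group_inject)
qed

lemma prep: "path (prep x)" "pclass (prep x) = x"
proof -
  have "\<exists>p. path p \<and> pclass p = x"
    by (metis path_group_cases)
  then show "path (prep x)" "pclass (prep x) = x"
    unfolding prep_def by (metis (mono_tags, lifting) someI_ex)+
qed

lemma homotopic_prep: "path p \<Longrightarrow> homotopic_paths UNIV (prep (pclass p)) p"
  using pclass_eq_iff[of "prep (pclass p)" p] by (simp add: prep)

instantiation path_group :: (topological_group_add) group_add
begin

definition zero_path_group :: "'a path_group" where
  "0 = pclass (\<lambda>_. 0)"

definition plus_path_group :: "'a path_group \<Rightarrow> 'a path_group \<Rightarrow> 'a path_group" where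
  "x + y = pclass (\<lambda>t. prep x t + prep y t)"

definition uminus_path_group :: "'a path_group \<Rightarrow> 'a path_group" where
  "- x = pclass (\<lambda>t. - prep x t)"

definition minus_path_group :: "'a path_group \<Rightarrow> 'a path_group \<Rightarrow> 'a path_group" where
  "x - y = x + - y" for x y :: "'a path_group"

lemma pclass_add: "path p \<Longrightarrow> path q \<Longrightarrow> pclass p + pclass q = pclass (\<lambda>t. p t + q t :: 'a)"
  unfolding plus_path_group_def by (intro pclass_eqI homotopic_paths_add homotopic_prep)

lemma pclass_uminus: "path p \<Longrightarrow> - pclass p = pclass (\<lambda>t. - p t :: 'a)"
  unfolding uminus_path_group_def by (intro pclass_eqI homotopic_paths_uminus homotopic_prep)

instance
proof
  fix x y z :: "'a path_group"
  obtain p q r where "path p" "x = pclass p" "path q" "y = pclass q" "path r" "z = pclass r"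
    by (metis path_group_cases)
  then show "x + y + z = x + (y + z)" "0 + x = x" "x + 0 = x" "- x + x = 0" "x + - y = x - y"
    by (simp_all add: pclass_add pclass_uminus path_add path_uminus path_const' zero_path_group_def
        minus_path_group_def add.assoc)
qed

end

lemma pclass_diff:
  "path p \<Longrightarrow> path q \<Longrightarrow> pclass p - pclass q = pclass (\<lambda>t. p t - q t :: 'a::topological_group_add)"
  unfolding diff_conv_add_uminus[of "pclass p"] by (simp add: pclass_add pclass_uminus path_uminus)

instantiation path_group :: (topological_space) topological_space
begin

definition open_path_group :: "'a path_group set \<Rightarrow> bool" where
  "open S \<longleftrightarrow> openin (quotient_topology path_space path_class) (Rep_path_group ` S)"

instance
proof
  show "open (UNIV :: 'a path_group set)"
    unfolding open_path_group_def range_Rep_path_group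
    using openin_topspace[of "quotient_topology path_space path_class"] by simp
  fix S T :: "'a path_group set"
  assume "open S" "open T"
  moreover have "Rep_path_group ` (S \<inter> T) = Rep_path_group ` S \<inter> Rep_path_group ` T"
    by (auto simp: Rep_path_group_inject)
  ultimately show "open (S \<inter> T)"
    by (simp add: open_path_group_def openin_Int)
next
  fix \<K> :: "'a path_group set set"
  assume "\<forall>S\<in>\<K>. open S"
  then show "open (\<Union>\<K>)"
    unfolding open_path_group_def image_Union by (intro openin_Union) auto
qed

end

lemma open_path_group_iff: "open S \<longleftrightarrow> openin path_space {p. path p \<and> pclass p \<in> S}"
proof -
  have "path_class p \<in> Rep_path_group ` S \<longleftrightarrow> pclass p \<in> S" if "path p" for p
    by (metis Rep_pclass[OF that] Rep_path_group_inject image_iff)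
  then have "{p \<in> topspace path_space. path_class p \<in> Rep_path_group ` S} = {p. path p \<and> pclass p \<in> S}"
    by auto
  then show ?thesis
    using Rep_path_group by (auto simp: open_path_group_def openin_quotient_topology)
qed

lemma homeomorphic_maps_path_group:
  "homeomorphic_maps euclidean (quotient_topology path_space path_class)
     (Rep_path_group :: 'a::topological_space path_group \<Rightarrow> _) Abs_path_group"
proof -
  have "homeomorphic_map euclidean (quotient_topology path_space path_class) (Rep_path_group :: 'a path_group \<Rightarrow> _)"
  proof (rule bijective_open_imp_homeomorphic_map)
    show "continuous_map euclidean (quotient_topology path_space path_class)
        (Rep_path_group :: 'a path_group \<Rightarrow> _)"
      unfolding continuous_map
    proof (intro conjI allI impI)
      fix U :: "(real \<Rightarrow> 'a) set set" assume U: "openin (quotient_topology path_space path_class) U"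
      then have "U \<subseteq> range Rep_path_group"
        using openin_subset[OF U] by (simp add: range_Rep_path_group)
      then have "Rep_path_group ` {x \<in> topspace euclidean. Rep_path_group x \<in> U} = U"
        by auto
      then show "openin euclidean {x \<in> topspace euclidean. Rep_path_group x \<in> U}"
        using U by (simp add: open_path_group_def)
    qed (simp add: range_Rep_path_group)
    show "open_map euclidean (quotient_topology path_space path_class) (Rep_path_group :: 'a path_group \<Rightarrow> _)"
      by (simp add: open_map_def open_path_group_def)
  qed (simp_all add: range_Rep_path_group inj_on_def Rep_path_group_inject)
  then obtain g where g:
      "homeomorphic_maps euclidean (quotient_topology path_space path_class) (Rep_path_group :: 'a path_group \<Rightarrow> _) g"
    unfolding homeomorphic_map_maps by blast
  moreover have "g c = Abs_path_group c" if "c \<in> topspace (quotient_topology path_space path_class)" for c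
  proof -
    have "c \<in> range Rep_path_group"
      using that by (simp add: range_Rep_path_group)
    then show ?thesis
      using g by (auto simp: homeomorphic_maps_def Rep_path_group_inverse)
  qed
  ultimately show ?thesis
    using homeomorphic_maps_eq by (metis (no_types, lifting))
qed

text \<open>The saturation of an open set is a union of translates, one for each null-homotopic loop.\<close>

lemma open_pclass_image:
  fixes S :: "(real \<Rightarrow> 'a::topological_group_add) set"
  assumes "openin path_space S"
  shows "open (pclass ` S)"
proof -
  have S: "path p" if "p \<in> S" for p
    using openin_subset[OF assms] that by auto
  have "{p. path p \<and> pclass p \<in> pclass ` S} =
      (\<Union>n\<in>{n. path n \<and> pclass n = 0}. {p. path p \<and> (\<lambda>t. p t + n t) \<in> S})"
  proof (intro equalityI subsetI)
    fix p assume "p \<in> {p. path p \<and> pclass p \<in> pclass ` S}"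
    then obtain s where s: "s \<in> S" "path p" "pclass p = pclass s"
      by auto
    define n where "n t = - p t + s t" for t
    have "pclass n = - pclass p + pclass s"
      unfolding n_def pclass_uminus[OF s(2)] by (rule pclass_add[OF path_uminus[OF s(2)] S[OF s(1)], symmetric])
    then have "pclass n = 0"
      by (simp add: s)
    moreover have "path n"
      unfolding n_def by (simp add: path_add path_uminus s S)
    moreover have "(\<lambda>t. p t + n t) = s"
      by (simp add: n_def flip: add.assoc)
    ultimately show "p \<in> (\<Union>n\<in>{n. path n \<and> pclass n = 0}. {p. path p \<and> (\<lambda>t. p t + n t) \<in> S})"
      using s by auto
  next
    fix p assume "p \<in> (\<Union>n\<in>{n. path n \<and> pclass n = 0}. {p. path p \<and> (\<lambda>t. p t + n t) \<in> S})"
    then obtain n where n: "path n" "pclass n = 0" "path p" "(\<lambda>t. p t + n t) \<in> S"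
      by blast
    have "pclass p = pclass (\<lambda>t. p t + n t)"
      using pclass_add[OF n(3,1)] n(2) by simp
    then show "p \<in> {p. path p \<and> pclass p \<in> pclass ` S}"
      using n by auto
  qed
  then show ?thesis
    unfolding open_path_group_iff using assms
    by (auto intro!: openin_Union openin_path_space_translate)
qed

instance path_group :: (topological_group_add) topological_group_add
proof
  fix x y :: "'a path_group"
  obtain p q where pq: "path p" "x = pclass p" "path q" "y = pclass q"
    by (metis path_group_cases)
  show "LIM z (nhds x \<times>\<^sub>F nhds y). fst z + snd z :> nhds (x + y)"
  proof (rule topological_tendstoI)
    fix S :: "'a path_group set" assume S: "open S" "x + y \<in> S"
    have "(\<lambda>t. p t + q t) \<in> {p. path p \<and> pclass p \<in> S}"
      using S(2) pq by (simp add: pclass_add path_add)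
    from path_space_add_nbhd[OF S(1)[unfolded open_path_group_iff] pq(1,3) this]
    obtain A B where AB: "openin path_space A" "openin path_space B" "p \<in> A" "q \<in> B"
      and sub: "\<forall>p'\<in>A. \<forall>q'\<in>B. (\<lambda>t. p' t + q' t) \<in> {p. path p \<and> pclass p \<in> S}"
      by blast
    have *: "x' + y' \<in> S" if xy: "x' \<in> pclass ` A" "y' \<in> pclass ` B" for x' y'
    proof -
      obtain p' q' where pq': "p' \<in> A" "x' = pclass p'" "q' \<in> B" "y' = pclass q'"
        using xy by blast
      have "path p'" "path q'"
        using openin_subset[OF AB(1)] openin_subset[OF AB(2)] pq' by auto
      then show ?thesis
        using sub pq' by (simp add: pclass_add)
    qed
    have nhds: "eventually (\<lambda>z. z \<in> pclass ` A) (nhds x)" "eventually (\<lambda>z. z \<in> pclass ` B) (nhds y)"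
      using open_pclass_image[OF AB(1)] open_pclass_image[OF AB(2)] AB pq
      by (auto intro!: eventually_nhds_in_open)
    show "eventually (\<lambda>z. fst z + snd z \<in> S) (nhds x \<times>\<^sub>F nhds y)"
      by (rule eventually_mono[OF eventually_prodI[OF nhds]]) (simp add: *)
  qed
  show "(uminus \<longlongrightarrow> - x) (nhds x)"
  proof (rule topological_tendstoI)
    fix S :: "'a path_group set" assume S: "open S" "- x \<in> S"
    have "openin path_space {p \<in> topspace path_space. (\<lambda>t. - p t) \<in> {p. path p \<and> pclass p \<in> S}}"
      using openin_continuous_map_preimage[OF continuous_map_path_space_uminus]
        S(1)[unfolded open_path_group_iff] by blast
    also have "{p \<in> topspace path_space. (\<lambda>t. - p t) \<in> {p. path p \<and> pclass p \<in> S}} =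
        {p. path p \<and> pclass p \<in> uminus -` S}"
      by (auto simp: path_uminus pclass_uminus)
    finally have "open (uminus -` S)"
      by (simp add: open_path_group_iff)
    then show "eventually (\<lambda>z. - z \<in> S) (nhds x)"
      using S(2) eventually_nhds_in_open[of "uminus -` S" x] by simp
  qed
qed

section \<open>The groupoid structure\<close>

definition prange :: "'a::topological_space path_group \<Rightarrow> 'a" where
  "prange x = pathfinish (prep x)"

definition psource :: "'a::topological_space path_group \<Rightarrow> 'a" where
  "psource x = pathstart (prep x)"

definition pconst :: "'a::topological_space \<Rightarrow> 'a path_group" where
  "pconst a = pclass (\<lambda>_. a)"

lemma prange_pclass [simp]: "path p \<Longrightarrow> prange (pclass p) = pathfinish p"
  unfolding prange_def using homotopic_paths_imp_pathfinish[OF homotopic_prep] .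

lemma psource_pclass [simp]: "path p \<Longrightarrow> psource (pclass p) = pathstart p"
  unfolding psource_def using homotopic_paths_imp_pathstart[OF homotopic_prep] .

lemma prange_pconst [simp]: "prange (pconst a) = a"
  by (simp add: pconst_def path_const' pathfinish_def)

lemma psource_pconst [simp]: "psource (pconst a) = a"
  by (simp add: pconst_def path_const' pathstart_def)

lemma
  fixes x y :: "'a::topological_group_add path_group"
  shows prange_add [simp]: "prange (x + y) = prange x + prange y"
    and psource_add [simp]: "psource (x + y) = psource x + psource y"
    and prange_uminus [simp]: "prange (- x) = - prange x"
    and psource_uminus [simp]: "psource (- x) = - psource x"
    and prange_diff [simp]: "prange (x - y) = prange x - prange y"
    and psource_diff [simp]: "psource (x - y) = psource x - psource y"
proof -
  obtain p q where "path p" "x = pclass p" "path q" "y = pclass q"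
    by (metis path_group_cases)
  then show "prange (x + y) = prange x + prange y" "psource (x + y) = psource x + psource y"
      "prange (- x) = - prange x" "psource (- x) = - psource x"
      "prange (x - y) = prange x - prange y" "psource (x - y) = psource x - psource y"
    by (simp_all add: pclass_add pclass_uminus pclass_diff path_add path_uminus path_diff
        pathstart_def pathfinish_def)
qed

lemma pconst_0 [simp]: "pconst 0 = (0 :: 'a::topological_group_add path_group)"
  by (simp add: pconst_def zero_path_group_def)

lemma prange_0 [simp]: "prange (0 :: 'a::topological_group_add path_group) = 0"
  and psource_0 [simp]: "psource (0 :: 'a::topological_group_add path_group) = 0"
  by (simp_all flip: pconst_0)

lemma continuous_on_prange: "continuous_on UNIV (prange :: 'a::topological_space path_group \<Rightarrow> 'a)"
proof -
  have "open (prange -` U)" if "open U" for U :: "'a set"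
  proof -
    have "{p. path p \<and> pclass p \<in> prange -` U} = {p. path p \<and> p ` {1} \<subseteq> U}"
      by (auto simp: pathfinish_def)
    then show ?thesis
      using openin_path_space_maps_into[of "{1}" U] that by (simp add: open_path_group_iff)
  qed
  then show ?thesis
    by (simp add: continuous_on_open_vimage)
qed

lemma continuous_on_psource: "continuous_on UNIV (psource :: 'a::topological_space path_group \<Rightarrow> 'a)"
proof -
  have "open (psource -` U)" if "open U" for U :: "'a set"
  proof -
    have "{p. path p \<and> pclass p \<in> psource -` U} = {p. path p \<and> p ` {0} \<subseteq> U}"
      by (auto simp: pathstart_def)
    then show ?thesis
      using openin_path_space_maps_into[of "{0}" U] that by (simp add: open_path_group_iff)
  qed
  then show ?thesis
    by (simp add: continuous_on_open_vimage)
qed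

lemma continuous_map_const_path: "continuous_map euclidean path_space (\<lambda>a _. a)"
  unfolding path_space_def
proof (rule continuous_on_generated_topo)
  fix S :: "(real \<Rightarrow> 'a) set"
  assume "S \<in> {{p. path p \<and> p ` K \<subseteq> U} | K (U :: 'a set). compact K \<and> K \<subseteq> {0..1} \<and> open U}"
  then obtain K and U :: "'a set" where "open U" "S = {p. path p \<and> p ` K \<subseteq> U}"
    by blast
  then have "(\<lambda>a _. a) -` S = (if K = {} then UNIV else U)"
    by (auto simp: path_const')
  then show "openin euclidean ((\<lambda>a _. a) -` S \<inter> topspace euclidean)"
    using \<open>open U\<close> by simp
next
  have "(\<lambda>a _. a) ` topspace euclidean \<subseteq> topspace (path_space :: (real \<Rightarrow> 'a) topology)"
    by (auto simp: path_const')
  then show "(\<lambda>a _. a) ` topspace euclidean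
      \<subseteq> \<Union> {{p. path p \<and> p ` K \<subseteq> U} | K (U :: 'a set). compact K \<and> K \<subseteq> {0..1} \<and> open U}"
    unfolding path_space_def topology_generated_by_topspace .
qed

lemma continuous_on_pconst: "continuous_on UNIV (pconst :: 'a::topological_space \<Rightarrow> 'a path_group)"
proof -
  have "open (pconst -` S)" if "open S" for S :: "'a path_group set"
  proof -
    have "open {a \<in> topspace euclidean. (\<lambda>_. a) \<in> {p. path p \<and> pclass p \<in> S}}"
      using openin_continuous_map_preimage[OF continuous_map_const_path that[unfolded open_path_group_iff]]
      by (rule open_openin[THEN iffD2])
    also have "{a \<in> topspace euclidean. (\<lambda>_. a) \<in> {p. path p \<and> pclass p \<in> S}} = pconst -` S"
      by (auto simp: path_const' pconst_def)
    finally show ?thesis .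
  qed
  then show ?thesis
    by (simp add: continuous_on_open_vimage)
qed

lemma homotopic_paths_const_joinpaths:
  fixes p :: "real \<Rightarrow> 'a::topological_space"
  assumes "path p"
  shows "homotopic_paths UNIV p ((\<lambda>_. pathstart p) +++ p)"
proof (rule homotopic_paths_reparametrize[OF assms, where f = "\<lambda>t. max 0 (2 * t - 1)"])
  show "continuous_on {0..1} (\<lambda>t::real. max 0 (2 * t - 1))"
    by (intro continuous_intros)
  show "((\<lambda>_. pathstart p) +++ p) t = p (max 0 (2 * t - 1))" for t
    by (cases "t \<le> 1/2") (simp_all add: joinpaths_def pathstart_def max_absorb1 max_absorb2)
qed auto

lemma homotopic_paths_joinpaths_const:
  fixes p :: "real \<Rightarrow> 'a::topological_space"
  assumes "path p"
  shows "homotopic_paths UNIV p (p +++ (\<lambda>_. pathfinish p))"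
proof (rule homotopic_paths_reparametrize[OF assms, where f = "\<lambda>t. min 1 (2 * t)"])
  show "continuous_on {0..1} (\<lambda>t::real. min 1 (2 * t))"
    by (intro continuous_intros)
  show "(p +++ (\<lambda>_. pathfinish p)) t = p (min 1 (2 * t))" for t
    by (cases "t \<le> 1/2") (simp_all add: joinpaths_def pathfinish_def min_absorb1 min_absorb2)
qed auto

text \<open>With \<open>a\<close> the common endpoint, \<open>q +++ p\<close> is literally the pointwise sum of \<open>const a +++ p\<close>,
  \<open>- a\<close> and \<open>q +++ const a\<close>.\<close>

lemma pclass_joinpaths:
  fixes p q :: "real \<Rightarrow> 'a::topological_group_add"
  assumes "path p" "path q" "pathfinish q = pathstart p"
  shows "pclass (q +++ p) = pclass p - pconst (pathstart p) + pclass q"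
proof -
  define a where "a = pathstart p"
  have paths: "path ((\<lambda>_. a) +++ p)" "path (q +++ (\<lambda>_. a))" "path (\<lambda>_::real. a)"
    using assms by (auto intro!: path_join_imp path_const' simp: a_def pathfinish_def pathstart_def)
  have "pclass p = pclass ((\<lambda>_. a) +++ p)" "pclass q = pclass (q +++ (\<lambda>_. a))"
    using homotopic_paths_const_joinpaths[OF assms(1)] homotopic_paths_joinpaths_const[OF assms(2)] assms(3)
    by (auto intro!: pclass_eqI simp: a_def)
  moreover have "q +++ p = (\<lambda>t. ((\<lambda>_. a) +++ p) t - a + (q +++ (\<lambda>_. a)) t)"
    by (auto simp: joinpaths_def)
  ultimately show ?thesis
    unfolding pconst_def a_def[symmetric]
    using paths by (simp add: pclass_add pclass_diff path_diff)
qed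

lemma homotopic_paths_add_reversepath:
  fixes p :: "real \<Rightarrow> 'a::topological_group_add"
  assumes "path p"
  shows "homotopic_paths UNIV (\<lambda>_. pathfinish p) (\<lambda>t. p t - pathstart p + reversepath p t)"
proof -
  define h where "h = (\<lambda>z. p (fst z * snd z) - p 0 + p (fst z * (1 - snd z)) - p (fst z) + p 1)"
  have p: "continuous_on {0..1} p"
    using assms by (simp add: path_def)
  have "continuous_on ({0..1} \<times> {0..1}) h"
    unfolding h_def by (intro continuous_intros continuous_on_compose2[OF p]) (auto simp: mult_le_one)
  then show ?thesis
    unfolding homotopic_paths
    by (intro exI[of _ h]) (auto simp: h_def reversepath_def pathstart_def pathfinish_def)
qed

lemma pclass_reversepath:
  fixes p :: "real \<Rightarrow> 'a::topological_group_add"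
  assumes "path p"
  shows "pclass (reversepath p) = pconst (pathstart p) - pclass p + pconst (pathfinish p)"
proof -
  have "pconst (pathfinish p) = pclass p - pconst (pathstart p) + pclass (reversepath p)"
    using pclass_eqI[OF homotopic_paths_add_reversepath[OF assms]] assms
    by (simp add: pconst_def pclass_add pclass_diff path_diff path_const')
  then show ?thesis
    by (simp add: diff_conv_add_uminus add.assoc del: add_uminus_conv_diff)
qed

lemma garrows_fundamental_groupoid:
  "garrows fundamental_groupoid = quotient_topology path_space path_class"
  by (simp add: fundamental_groupoid_def)

lemma gunits_fundamental_groupoid [simp]: "gunits fundamental_groupoid = euclidean"
  by (simp add: fundamental_groupoid_def)

lemma topspace_arrows_fundamental_groupoid [simp]:
  "topspace (garrows fundamental_groupoid) = range Rep_path_group"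
  by (simp add: garrows_fundamental_groupoid range_Rep_path_group)

lemma grange_fundamental_groupoid [simp]:
  "grange fundamental_groupoid (Rep_path_group x) = prange x"
proof -
  obtain p where p: "path p" "x = pclass p"
    by (rule path_group_cases)
  have "pathfinish ` path_class p = {pathfinish p}"
    using homotopic_paths_imp_pathfinish[of UNIV p] p(1) mem_path_class_iff[of p p] by (fastforce simp: path_class_def)
  then show ?thesis
    using p by (simp add: fundamental_groupoid_def Rep_pclass)
qed

lemma gsource_fundamental_groupoid [simp]:
  "gsource fundamental_groupoid (Rep_path_group x) = psource x"
proof -
  obtain p where p: "path p" "x = pclass p"
    by (rule path_group_cases)
  have "pathstart ` path_class p = {pathstart p}"
    using homotopic_paths_imp_pathstart[of UNIV p] p(1) mem_path_class_iff[of p p] by (fastforce simp: path_class_def)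
  then show ?thesis
    using p by (simp add: fundamental_groupoid_def Rep_pclass)
qed

lemma gident_fundamental_groupoid [simp]:
  "gident fundamental_groupoid a = Rep_path_group (pconst a)"
  by (simp add: fundamental_groupoid_def pconst_def Rep_pclass path_const')

lemma ginv_fundamental_groupoid [simp]:
  "ginv fundamental_groupoid (Rep_path_group x) =
     Rep_path_group (pconst (psource x) - x + pconst (prange x))"
proof -
  obtain p where p: "path p" "x = pclass p"
    by (rule path_group_cases)
  have "reversepath ` path_class p = path_class (reversepath p)"
  proof (intro equalityI subsetI)
    fix q assume "q \<in> path_class (reversepath p)"
    then have "homotopic_paths UNIV (reversepath (reversepath p)) (reversepath q)"
      unfolding mem_path_class_iff by (rule homotopic_paths_reversepath_D)
    then have "reversepath q \<in> path_class p"
      by (simp add: mem_path_class_iff)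
    then have "reversepath (reversepath q) \<in> reversepath ` path_class p"
      by (rule imageI)
    then show "q \<in> reversepath ` path_class p"
      by simp
  qed (auto simp: mem_path_class_iff homotopic_paths_reversepath)
  then show ?thesis
    using p by (simp add: fundamental_groupoid_def Rep_pclass flip: pclass_reversepath)
qed

lemma gmult_fundamental_groupoid [simp]:
  assumes "psource x = prange y"
  shows "gmult fundamental_groupoid (Rep_path_group x) (Rep_path_group y) =
     Rep_path_group (x - pconst (psource x) + y)"
proof -
  obtain p q where pq: "path p" "x = pclass p" "path q" "y = pclass q"
    by (metis path_group_cases)
  have eq: "pathfinish q = pathstart p"
    using assms pq by simp
  have "path_class (q' +++ p') = path_class (q +++ p)"
    if "p' \<in> path_class p" "q' \<in> path_class q" for p' q'
  proof -
    have h: "homotopic_paths UNIV p p'" "homotopic_paths UNIV q q'"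
      using that by (simp_all add: mem_path_class_iff)
    then have "homotopic_paths UNIV (q +++ p) (q' +++ p')"
      using eq by (intro homotopic_paths_join)
    then show ?thesis
      by (metis path_class_eq_iff homotopic_paths_imp_path)
  qed
  moreover have "p \<in> path_class p" "q \<in> path_class q"
    using pq by (auto simp: mem_path_class_iff)
  ultimately have "(\<Union>p'\<in>path_class p. \<Union>q'\<in>path_class q. path_class (q' +++ p')) = path_class (q +++ p)"
    by blast
  then show ?thesis
    using pq eq pclass_joinpaths[OF pq(1,3) eq]
    by (simp add: fundamental_groupoid_def Rep_pclass path_join_imp flip: Rep_pclass)
qed

lemma homeomorphic_maps_arrows:
  "homeomorphic_maps euclidean (garrows fundamental_groupoid) Rep_path_group Abs_path_group"
  unfolding garrows_fundamental_groupoid by (rule homeomorphic_maps_path_group)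

lemma
  shows continuous_map_Rep_path_group:
      "continuous_map euclidean (garrows fundamental_groupoid) Rep_path_group"
    and continuous_map_Abs_path_group:
      "continuous_map (garrows fundamental_groupoid) euclidean Abs_path_group"
  using homeomorphic_maps_arrows by (auto simp: homeomorphic_maps_def)

theorem topological_groupoid_fundamental_groupoid:
  "topological_groupoid (fundamental_groupoid :: ('a::topological_group_add, (real \<Rightarrow> 'a) set) groupoid)"
    (is "topological_groupoid ?G")
proof
  have lift: "continuous_map (garrows ?G) X (\<lambda>c. f (Abs_path_group c))"
    if "continuous_map euclidean X f" for X :: "'c topology" and f :: "'a path_group \<Rightarrow> 'c"
    using continuous_map_compose[OF continuous_map_Abs_path_group that] by (simp add: o_def)
  show "continuous_map (garrows ?G) (gunits ?G) (grange ?G)"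
  proof (rule continuous_map_eq[OF lift])
    show "continuous_map euclidean (gunits ?G) prange"
      using continuous_on_prange by simp
  qed (auto simp: Rep_path_group_inverse)
  show "continuous_map (garrows ?G) (gunits ?G) (gsource ?G)"
  proof (rule continuous_map_eq[OF lift])
    show "continuous_map euclidean (gunits ?G) psource"
      using continuous_on_psource by simp
  qed (auto simp: Rep_path_group_inverse)
  show "continuous_map (gunits ?G) (garrows ?G) (gident ?G)"
    using continuous_map_compose[OF _ continuous_map_Rep_path_group, of euclidean pconst]
      continuous_on_pconst by (simp add: o_def flip: gident_fundamental_groupoid)
  show "continuous_map (garrows ?G) (garrows ?G) (ginv ?G)"
  proof (rule continuous_map_eq[OF lift])
    have "continuous_map euclidean euclidean
        (\<lambda>x :: 'a path_group. pconst (psource x) - x + pconst (prange x))"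
      by (simp, intro continuous_intros continuous_on_compose2[OF continuous_on_pconst]
          continuous_on_psource continuous_on_prange) auto
    from continuous_map_compose[OF this continuous_map_Rep_path_group]
    show "continuous_map euclidean (garrows ?G)
        (\<lambda>x. Rep_path_group (pconst (psource x) - x + pconst (prange x)))"
      by (simp add: o_def)
  qed (auto simp: Rep_path_group_inverse)
  show "continuous_map (subtopology (prod_topology (garrows ?G) (garrows ?G)) (composable ?G))
      (garrows ?G) (\<lambda>(x, y). gmult ?G x y)"
  proof (rule continuous_map_eq)
    have "continuous_map (prod_topology (garrows ?G) (garrows ?G)) (prod_topology euclidean euclidean)
        (\<lambda>z. (Abs_path_group (fst z), Abs_path_group (snd z)))"
      using continuous_map_Abs_path_group
      by (intro continuous_map_pairedI) (auto intro: continuous_map_compose[unfolded o_def] continuous_map_fst continuous_map_snd)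
    moreover have "continuous_map (prod_topology euclidean euclidean) euclidean
        (\<lambda>z :: 'a path_group \<times> 'a path_group. fst z - pconst (psource (fst z)) + snd z)"
      by (simp, intro continuous_intros continuous_on_compose2[OF continuous_on_pconst]
          continuous_on_compose2[OF continuous_on_psource]) auto
    ultimately have "continuous_map (prod_topology (garrows ?G) (garrows ?G)) (garrows ?G)
        (\<lambda>z. Rep_path_group (Abs_path_group (fst z) - pconst (psource (Abs_path_group (fst z)))
               + Abs_path_group (snd z)))"
      using continuous_map_compose[OF continuous_map_compose continuous_map_Rep_path_group]
      by (fastforce simp: o_def)
    then show "continuous_map (subtopology (prod_topology (garrows ?G) (garrows ?G)) (composable ?G))
        (garrows ?G) (\<lambda>z. Rep_path_group (Abs_path_group (fst z) - pconst (psource (Abs_path_group (fst z)))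
               + Abs_path_group (snd z)))"
      by (rule continuous_map_from_subtopology)
  qed (auto simp: composable_def Rep_path_group_inverse)
qed (auto simp: composable_def add.assoc diff_conv_add_uminus simp del: add_uminus_conv_diff)

section \<open>Local structure\<close>

lemma path_space_const_nbhd:
  assumes "openin path_space S" "(\<lambda>_. a) \<in> S"
  obtains V :: "'a::topological_space set" where "open V" "a \<in> V"
    "\<And>q. path q \<Longrightarrow> q ` {0..1} \<subseteq> V \<Longrightarrow> q \<in> S"
proof -
  have "generate_topology_on
      {{p. path p \<and> p ` K \<subseteq> U} | K (U :: 'a set). compact K \<and> K \<subseteq> {0..1} \<and> open U} S"
    using assms(1) unfolding path_space_def by (rule openin_topology_generated_by)
  then have "\<exists>V. open V \<and> a \<in> V \<and> (\<forall>q. path q \<longrightarrow> q ` {0..1} \<subseteq> V \<longrightarrow> q \<in> S)"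
    using assms(2)
  proof induction
    case Empty
    then show ?case
      by simp
  next
    case (Int S S')
    then obtain V V' where "open V" "a \<in> V" "\<forall>q. path q \<longrightarrow> q ` {0..1} \<subseteq> V \<longrightarrow> q \<in> S"
        "open V'" "a \<in> V'" "\<forall>q. path q \<longrightarrow> q ` {0..1} \<subseteq> V' \<longrightarrow> q \<in> S'"
      by auto
    then show ?case
      by (intro exI[of _ "V \<inter> V'"]) auto
  next
    case (UN \<K>)
    then obtain S where S: "S \<in> \<K>" "(\<lambda>_. a) \<in> S"
      by blast
    with UN.IH[OF this] show ?case
      by (meson UnionI)
  next
    case (Basis S)
    then obtain K and U :: "'a set" where K: "K \<subseteq> {0..1}" "open U" "S = {p. path p \<and> p ` K \<subseteq> U}"
      by blast
    show ?case
      using K Basis.prems by (intro exI[of _ "if K = {} then UNIV else U"]) auto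
  qed
  then show thesis
    using that by blast
qed

lemma open_image_ends:
  assumes lpc: "locally path_connected (UNIV :: 'a::topological_group_add set)"
    and S: "open S"
  shows "open ((\<lambda>x :: 'a path_group. (prange x, psource x)) ` S)"
proof (subst open_subopen, clarify)
  fix x assume x: "x \<in> S"
  have "open ((\<lambda>y. x + y) -` S)"
    by (intro open_vimage S continuous_intros)
  then have op: "openin path_space {p. path p \<and> pclass p \<in> (\<lambda>y. x + y) -` S}"
    unfolding open_path_group_iff .
  have "(\<lambda>_. 0) \<in> {p. path p \<and> pclass p \<in> (\<lambda>y. x + y) -` S}"
    using x by (simp add: path_const' flip: zero_path_group_def)
  from path_space_const_nbhd[OF op this] obtain V :: "'a set" where V: "open V" "0 \<in> V"
      "\<And>q. path q \<Longrightarrow> q ` {0..1} \<subseteq> V \<Longrightarrow> q \<in> {p. path p \<and> pclass p \<in> (\<lambda>y. x + y) -` S}"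
    by metis
  obtain V' where V': "open V'" "path_connected V'" "0 \<in> V'" "V' \<subseteq> V"
    using lpc[unfolded locally_path_connected, rule_format, of V 0] V(1,2) by auto
  define N where "N = (\<lambda>z. - prange x + fst z) -` V' \<inter> (\<lambda>z. - psource x + snd z) -` V'"
  have "open N"
    unfolding N_def by (intro open_Int open_vimage V'(1) continuous_intros)
  moreover have "(prange x, psource x) \<in> N"
    using V'(3) by (simp add: N_def)
  moreover have "N \<subseteq> (\<lambda>x. (prange x, psource x)) ` S"
  proof clarify
    fix a b assume "(a, b) \<in> N"
    then have "- psource x + b \<in> V'" "- prange x + a \<in> V'"
      by (simp_all add: N_def)
    then obtain q where q: "path q" "path_image q \<subseteq> V'" "pathstart q = - psource x + b"
        "pathfinish q = - prange x + a"
      using V'(2) unfolding path_connected_def by blast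
    then have "x + pclass q \<in> S"
      using V(3)[of q] V'(4) by (auto simp: path_image_def)
    moreover have "(a, b) = (prange (x + pclass q), psource (x + pclass q))"
      using q by simp
    ultimately show "(a, b) \<in> (\<lambda>x. (prange x, psource x)) ` S"
      by (rule rev_image_eqI)
  qed
  ultimately show "\<exists>T. open T \<and> (prange x, psource x) \<in> T \<and> T \<subseteq> (\<lambda>x. (prange x, psource x)) ` S"
    by blast
qed

lemma continuous_on_ends:
  "continuous_on A (\<lambda>x :: 'a::topological_space path_group. (prange x, psource x))"
  by (intro continuous_on_Pair continuous_on_subset[OF continuous_on_prange]
      continuous_on_subset[OF continuous_on_psource]) auto

lemma ends_locally_injective:
  assumes slsc: "semilocally_simply_connected (UNIV :: 'a::topological_group_add set)"
  obtains V :: "'a::topological_group_add path_group set" where "open V" "0 \<in> V"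
    "\<And>v w. v \<in> V \<Longrightarrow> w \<in> V \<Longrightarrow> prange (v - w) = 0 \<Longrightarrow> psource (v - w) = 0 \<Longrightarrow> v = w"
proof -
  obtain W :: "'a set" where W: "open W" "0 \<in> W"
    "\<And>p. path p \<Longrightarrow> path_image p \<subseteq> W \<Longrightarrow> pathstart p = 0 \<Longrightarrow> pathfinish p = 0
        \<Longrightarrow> homotopic_paths UNIV p (\<lambda>_. 0)"
    using bspec[OF slsc[unfolded semilocally_simply_connected_def], of 0] by auto
  define N :: "'a path_group set" where "N = pclass ` {p. path p \<and> p ` {0..1} \<subseteq> W}"
  have N: "open N" "0 \<in> N"
    unfolding N_def using W(1,2)
    by (auto simp: zero_path_group_def path_const'
        intro!: open_pclass_image openin_path_space_maps_into imageI)
  have ker: "z = 0" if z: "z \<in> N" "prange z = 0" "psource z = 0" for z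
  proof -
    obtain p where "path p" "p ` {0..1} \<subseteq> W" "z = pclass p"
      using z(1) by (auto simp: N_def)
    then have "homotopic_paths UNIV p (\<lambda>_. 0)"
      using z(2,3) by (intro W(3)) (simp_all add: path_image_def)
    then show ?thesis
      unfolding \<open>z = pclass p\<close> zero_path_group_def by (rule pclass_eqI)
  qed
  obtain V where V: "open V" "0 \<in> V" "\<And>v w. v \<in> V \<Longrightarrow> w \<in> V \<Longrightarrow> v - w \<in> N"
    by (rule nbhd_0_diff_subset[OF N]) blast
  show thesis
  proof (rule that[OF V(1,2)])
    show "v = w" if "v \<in> V" "w \<in> V" "prange (v - w) = 0" "psource (v - w) = 0" for v w
      using ker[OF V(3)[OF that(1,2)] that(3,4)] by simp
  qed
qed

lemma Hausdorff_space_t2: "Hausdorff_space (euclidean :: 'b::t2_space topology)"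
  unfolding Hausdorff_space_def
proof (intro allI impI; elim conjE)
  fix x y :: 'b assume "x \<noteq> y"
  from hausdorff[OF this] obtain U V where "open U" "open V" "x \<in> U" "y \<in> V" "U \<inter> V = {}"
    by blast
  then show "\<exists>U V. openin euclidean U \<and> openin euclidean V \<and> x \<in> U \<and> y \<in> V \<and> disjnt U V"
    by (intro exI[of _ U] exI[of _ V]) (simp add: disjnt_def)
qed

lemma Hausdorff_path_group:
  assumes slsc: "semilocally_simply_connected (UNIV :: 'a::{topological_group_add, t2_space} set)"
  shows "Hausdorff_space (euclidean :: 'a path_group topology)"
  unfolding Hausdorff_space_def
proof (intro allI impI; elim conjE)
  fix x y :: "'a path_group" assume "x \<noteq> y"
  show "\<exists>U V. openin euclidean U \<and> openin euclidean V \<and> x \<in> U \<and> y \<in> V \<and> disjnt U V"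
  proof (cases "(prange x, psource x) = (prange y, psource y)")
    case False
    then obtain A B where AB: "open A" "open B" "(prange x, psource x) \<in> A"
        "(prange y, psource y) \<in> B" "A \<inter> B = {}"
      using hausdorff by metis
    have "open ((\<lambda>x. (prange x, psource x)) -` A)" "open ((\<lambda>x. (prange x, psource x)) -` B)"
      by (intro open_vimage AB continuous_on_ends)+
    then show ?thesis
      using AB(3-5)
      by (intro exI[of _ "(\<lambda>x. (prange x, psource x)) -` A"] exI[of _ "(\<lambda>x. (prange x, psource x)) -` B"])
         (auto simp: disjnt_iff)
  next
    case True
    obtain V :: "'a path_group set" where V: "open V" "0 \<in> V"
      "\<And>v w. v \<in> V \<Longrightarrow> w \<in> V \<Longrightarrow> prange (v - w) = 0 \<Longrightarrow> psource (v - w) = 0 \<Longrightarrow> v = w"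
      by (rule ends_locally_injective[OF slsc]) blast
    have "x + v \<noteq> y + w" if vw: "v \<in> V" "w \<in> V" for v w
    proof
      assume eq: "x + v = y + w"
      have "prange (x + v) = prange (y + w)" "psource (x + v) = psource (y + w)"
        by (simp_all only: eq)
      then have "prange (v - w) = 0" "psource (v - w) = 0"
        using True by simp_all
      then have "v = w"
        using V(3) vw by blast
      with eq \<open>x \<noteq> y\<close> show False
        by simp
    qed
    then have "disjnt ((+) x ` V) ((+) y ` V)"
      by (fastforce simp: disjnt_iff)
    moreover have "x \<in> (+) x ` V" "y \<in> (+) y ` V"
      using V(2) by (auto simp: mem_translate_iff)
    ultimately show ?thesis
      using open_translate[OF V(1)] by (metis open_openin)
  qed
qed

lemma locally_compact_path_group:
  assumes lpc: "locally path_connected (UNIV :: 'a::{topological_group_add, t2_space} set)"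
    and slsc: "semilocally_simply_connected (UNIV :: 'a set)"
    and lc: "locally_compact_space (euclidean :: 'a topology)"
  shows "locally_compact_space (euclidean :: 'a path_group topology)"
proof -
  define \<phi> :: "'a path_group \<Rightarrow> 'a \<times> 'a" where "\<phi> x = (prange x, psource x)" for x
  obtain V :: "'a path_group set" where V: "open V" "0 \<in> V"
    "\<And>v w. v \<in> V \<Longrightarrow> w \<in> V \<Longrightarrow> prange (v - w) = 0 \<Longrightarrow> psource (v - w) = 0 \<Longrightarrow> v = w"
    by (rule ends_locally_injective[OF slsc]) blast
  have inj: "inj_on \<phi> V"
    using V(3) by (auto simp: inj_on_def \<phi>_def)
  have \<phi>_open: "open (\<phi> ` S)" if "open S" for S
    using open_image_ends[OF lpc that] unfolding \<phi>_def .
  have "locally_compact_space (euclidean :: ('a \<times> 'a) topology)"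
    using lc by (simp add: locally_compact_space_prod_topology flip: prod_topology_euclidean)
  then have "neighbourhood_base_of (compactin euclidean) (euclidean :: ('a \<times> 'a) topology)"
    by (rule locally_compact_space_neighbourhood_base[THEN iffD1, rotated]) (simp add: Hausdorff_space_t2)
  from this[unfolded neighbourhood_base_of, rule_format, of "\<phi> ` V" "\<phi> 0"]
  obtain U K where UK: "open U" "compact K" "\<phi> 0 \<in> U" "U \<subseteq> K" "K \<subseteq> \<phi> ` V"
    using \<phi>_open[OF V(1)] V(2) by auto
  define C where "C = inv_into V \<phi> ` K"
  have "continuous_on (\<phi> ` V) (inv_into V \<phi>)"
    unfolding continuous_on_open_vimage[OF \<phi>_open[OF V(1)]]
  proof clarify
    fix S :: "'a path_group set" assume "open S"
    have "inv_into V \<phi> -` S \<inter> \<phi> ` V = \<phi> ` (S \<inter> V)"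
      using inj by auto
    then show "open (inv_into V \<phi> -` S \<inter> \<phi> ` V)"
      using \<phi>_open[of "S \<inter> V"] \<open>open S\<close> V(1) by auto
  qed
  then have C: "compact C"
    unfolding C_def using UK(2,5) by (intro compact_continuous_image) (auto intro: continuous_on_subset)
  define N where "N = V \<inter> \<phi> -` U"
  have N: "open N"
    unfolding N_def \<phi>_def by (intro open_Int open_vimage V(1) UK(1) continuous_on_ends)
  have "N \<subseteq> C"
  proof
    fix x assume "x \<in> N"
    then have "\<phi> x \<in> K" "inv_into V \<phi> (\<phi> x) = x"
      using UK(4) inj by (auto simp: N_def)
    then show "x \<in> C"
      unfolding C_def by (metis imageI)
  qed
  have "0 \<in> N"
    using V(2) UK(3) by (simp add: N_def)
  show ?thesis
    unfolding locally_compact_space_def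
  proof
    fix x :: "'a path_group"
    have "open ((+) x ` N)" "compact ((+) x ` C)" "x \<in> (+) x ` N" "(+) x ` N \<subseteq> (+) x ` C"
      using open_translate[OF N] compact_translate[OF C] \<open>0 \<in> N\<close> \<open>N \<subseteq> C\<close>
      by (auto simp: mem_translate_iff)
    then show "\<exists>U K. openin euclidean U \<and> compactin euclidean K \<and> x \<in> U \<and> U \<subseteq> K"
      by (intro exI[of _ "(+) x ` N"] exI[of _ "(+) x ` C"]) simp
  qed
qed

theorem locally_compact_groupoid_fundamental_groupoid:
  assumes "locally path_connected (UNIV :: 'a::{topological_group_add, t2_space} set)"
    and "semilocally_simply_connected (UNIV :: 'a set)"
    and "locally_compact_space (euclidean :: 'a topology)"
  shows "locally_compact_groupoid (fundamental_groupoid :: ('a, (real \<Rightarrow> 'a) set) groupoid)"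
proof -
  interpret topological_groupoid "fundamental_groupoid :: ('a, (real \<Rightarrow> 'a) set) groupoid"
    by (rule topological_groupoid_fundamental_groupoid)
  have homeo: "(euclidean :: 'a path_group topology) homeomorphic_space
      garrows (fundamental_groupoid :: ('a, (real \<Rightarrow> 'a) set) groupoid)"
    unfolding homeomorphic_space_def by (intro exI) (rule homeomorphic_maps_arrows)
  show ?thesis
  proof
    show "locally_compact_space (garrows (fundamental_groupoid :: ('a, (real \<Rightarrow> 'a) set) groupoid))"
      using locally_compact_path_group[OF assms] homeomorphic_locally_compact_space[OF homeo] by simp
    show "Hausdorff_space (garrows (fundamental_groupoid :: ('a, (real \<Rightarrow> 'a) set) groupoid))"
      using Hausdorff_path_group[OF assms(2)] homeomorphic_Hausdorff_space[OF homeo] by simp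
  qed
qed

section \<open>The universal cover\<close>

typedef (overloaded) 'a universal_cover = "{x :: 'a::topological_group_add path_group. prange x = 0}"
  morphisms cover_path Abs_cover
  by (intro exI[of _ 0]) simp

lemma prange_cover_path [simp]: "prange (cover_path h) = 0"
  using cover_path[of h] by simp

lemma cover_path_Abs_cover [simp]: "prange x = 0 \<Longrightarrow> cover_path (Abs_cover x) = x"
  by (simp add: Abs_cover_inverse)

instantiation universal_cover :: (topological_group_add) group_add
begin

definition zero_universal_cover :: "'a universal_cover" where
  "0 = Abs_cover 0"

definition plus_universal_cover :: "'a universal_cover \<Rightarrow> 'a universal_cover \<Rightarrow> 'a universal_cover" where
  "h + k = Abs_cover (cover_path h + cover_path k)"

definition uminus_universal_cover :: "'a universal_cover \<Rightarrow> 'a universal_cover" where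
  "- h = Abs_cover (- cover_path h)"

definition minus_universal_cover :: "'a universal_cover \<Rightarrow> 'a universal_cover \<Rightarrow> 'a universal_cover" where
  "h - k = h + - k" for h k :: "'a universal_cover"

lemma cover_path_add [simp]: "cover_path (h + k) = cover_path h + cover_path (k :: 'a universal_cover)"
  and cover_path_uminus [simp]: "cover_path (- h) = - cover_path (h :: 'a universal_cover)"
  and cover_path_0 [simp]: "cover_path 0 = (0 :: 'a path_group)"
  by (simp_all add: plus_universal_cover_def uminus_universal_cover_def zero_universal_cover_def)

instance
  by standard (simp_all add: minus_universal_cover_def add.assoc flip: cover_path_inject)

end

instantiation universal_cover :: (topological_group_add) topological_space
begin

definition open_universal_cover :: "'a universal_cover set \<Rightarrow> bool" where
  "open S \<longleftrightarrow> (\<exists>T. open T \<and> S = cover_path -` T)"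

instance
proof
  show "open (UNIV :: 'a universal_cover set)"
    unfolding open_universal_cover_def by (intro exI[of _ UNIV]) simp
  fix S S' :: "'a universal_cover set" assume "open S" "open S'"
  then obtain T T' where "open T" "open T'" "S = cover_path -` T" "S' = cover_path -` T'"
    unfolding open_universal_cover_def by blast
  then show "open (S \<inter> S')"
    unfolding open_universal_cover_def by (intro exI[of _ "T \<inter> T'"]) auto
next
  fix \<K> :: "'a universal_cover set set" assume "\<forall>S\<in>\<K>. open S"
  then have "\<forall>S\<in>\<K>. \<exists>T. open T \<and> S = cover_path -` T"
    by (simp only: open_universal_cover_def)
  then obtain f where f: "\<forall>S\<in>\<K>. open (f S) \<and> S = cover_path -` f S"
    unfolding bchoice_iff by (elim exE)
  then have "\<Union>\<K> = cover_path -` (\<Union>S\<in>\<K>. f S)"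
    by blast
  then show "open (\<Union>\<K>)"
    unfolding open_universal_cover_def using f by (intro exI[of _ "\<Union>S\<in>\<K>. f S"]) auto
qed

end

lemma tendsto_universal_cover_iff:
  "(f \<longlongrightarrow> l) F \<longleftrightarrow> ((\<lambda>z. cover_path (f z)) \<longlongrightarrow> cover_path l) F"
proof
  assume *: "(f \<longlongrightarrow> l) F"
  show "((\<lambda>z. cover_path (f z)) \<longlongrightarrow> cover_path l) F"
  proof (rule topological_tendstoI)
    fix T assume T: "open T" "cover_path l \<in> T"
    have "open (cover_path -` T)"
      unfolding open_universal_cover_def using T(1) by (intro exI[of _ T]) simp
    from topological_tendstoD[OF * this] T(2) have "eventually (\<lambda>z. f z \<in> cover_path -` T) F"
      by simp
    then show "eventually (\<lambda>z. cover_path (f z) \<in> T) F"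
      by simp
  qed
next
  assume *: "((\<lambda>z. cover_path (f z)) \<longlongrightarrow> cover_path l) F"
  show "(f \<longlongrightarrow> l) F"
  proof (rule topological_tendstoI)
    fix S assume "open S" "l \<in> S"
    then obtain T where T: "open T" "S = cover_path -` T"
      unfolding open_universal_cover_def by blast
    then have "eventually (\<lambda>z. cover_path (f z) \<in> T) F"
      using topological_tendstoD[OF *] \<open>l \<in> S\<close> by simp
    then show "eventually (\<lambda>z. f z \<in> S) F"
      by (simp add: T(2))
  qed
qed

lemma continuous_on_cover_path: "continuous_on UNIV cover_path"
  unfolding continuous_on_def
  by (intro ballI tendsto_universal_cover_iff[THEN iffD1] tendsto_ident_at)

lemma continuous_on_Abs_cover: "continuous_on {x. prange x = 0} Abs_cover"
  unfolding continuous_on_def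
proof
  fix x :: "'a path_group" assume x: "x \<in> {x. prange x = 0}"
  have "((\<lambda>z. z) \<longlongrightarrow> x) (at x within {x. prange x = 0})"
    by (rule tendsto_ident_at)
  moreover have "eventually (\<lambda>z. z = cover_path (Abs_cover z)) (at x within {x. prange x = 0})"
    by (auto simp: eventually_at_topological)
  ultimately have "((\<lambda>z. cover_path (Abs_cover z)) \<longlongrightarrow> x) (at x within {x. prange x = 0})"
    by (rule Lim_transform_eventually)
  then show "(Abs_cover \<longlongrightarrow> Abs_cover x) (at x within {x. prange x = 0})"
    using x by (simp add: tendsto_universal_cover_iff)
qed

instance universal_cover :: (topological_group_add) topological_group_add
proof
  fix h k :: "'a universal_cover"
  have fst: "((\<lambda>z. cover_path (fst z)) \<longlongrightarrow> cover_path h) (nhds h \<times>\<^sub>F nhds k)"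
    by (rule tendsto_universal_cover_iff[THEN iffD1]) (rule filterlim_fst)
  have snd: "((\<lambda>z. cover_path (snd z)) \<longlongrightarrow> cover_path k) (nhds h \<times>\<^sub>F nhds k)"
    by (rule tendsto_universal_cover_iff[THEN iffD1]) (rule filterlim_snd)
  show "LIM z (nhds h \<times>\<^sub>F nhds k). fst z + snd z :> nhds (h + k)"
    using tendsto_add[OF fst snd] by (simp add: tendsto_universal_cover_iff)
  have "((\<lambda>z. z) \<longlongrightarrow> h) (nhds h)"
    by (rule filterlim_ident)
  from tendsto_minus[OF this[unfolded tendsto_universal_cover_iff]]
  show "(uminus \<longlongrightarrow> - h) (nhds h)"
    by (simp add: tendsto_universal_cover_iff)
qed

lemma Hausdorff_universal_cover:
  assumes "semilocally_simply_connected (UNIV :: 'a::{topological_group_add, t2_space} set)"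
  shows "Hausdorff_space (euclidean :: 'a universal_cover topology)"
proof (rule Hausdorff_space_injective_preimage[OF Hausdorff_path_group[OF assms]])
  show "continuous_map euclidean euclidean (cover_path :: 'a universal_cover \<Rightarrow> _)"
    using continuous_on_cover_path by simp
  show "inj_on (cover_path :: 'a universal_cover \<Rightarrow> _) (topspace euclidean)"
    by (simp add: inj_on_def cover_path_inject)
qed

lemma compact_vimage_cover_path:
  fixes K :: "'a::{topological_group_add, t2_space} path_group set"
  assumes "compact K"
  shows "compact (cover_path -` K)"
proof -
  have "closed ((prange :: 'a path_group \<Rightarrow> 'a) -` {0})"
    by (intro closed_vimage continuous_on_prange) simp
  then have "compact (K \<inter> prange -` {0})"
    using assms by (rule compact_Int_closed[rotated])
  then have "compact (Abs_cover ` (K \<inter> prange -` {0}))"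
    by (rule compact_continuous_image[rotated]) (auto intro: continuous_on_subset[OF continuous_on_Abs_cover])
  also have "Abs_cover ` (K \<inter> prange -` {0}) = cover_path -` K"
  proof (intro equalityI subsetI)
    fix h assume "h \<in> cover_path -` K"
    then have "cover_path h \<in> K \<inter> prange -` {0}"
      by simp
    then have "Abs_cover (cover_path h) \<in> Abs_cover ` (K \<inter> prange -` {0})"
      by (rule imageI)
    then show "h \<in> Abs_cover ` (K \<inter> prange -` {0})"
      by (simp add: cover_path_inverse)
  qed auto
  finally show ?thesis .
qed

lemma locally_compact_universal_cover:
  assumes "locally path_connected (UNIV :: 'a::{topological_group_add, t2_space} set)"
    and "semilocally_simply_connected (UNIV :: 'a set)"
    and "locally_compact_space (euclidean :: 'a topology)"
  shows "locally_compact_space (euclidean :: 'a universal_cover topology)"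
  unfolding locally_compact_space_def
proof
  fix h :: "'a universal_cover"
  from locally_compact_path_group[OF assms, unfolded locally_compact_space_def, rule_format, of "cover_path h"]
  obtain U K where UK: "open U" "compact K" "cover_path h \<in> U" "U \<subseteq> K"
    by auto
  have "open (cover_path -` U)"
    using UK(1) continuous_on_cover_path by (rule open_vimage)
  moreover have "compact (cover_path -` K)"
    using UK(2) by (rule compact_vimage_cover_path)
  ultimately show "\<exists>U K. openin euclidean U \<and> compactin euclidean K \<and> h \<in> U \<and> U \<subseteq> K"
    using UK(3,4) by (intro exI[of _ "cover_path -` U"] exI[of _ "cover_path -` K"]) auto
qed

section \<open>The Haar system\<close>

lemma space_borel_of [simp]: "space (borel_of T) = topspace T"
  by (auto simp: borel_of_def space_measure_of_conv)

lemma openin_in_sets_borel_of: "openin T U \<Longrightarrow> U \<in> sets (borel_of T)"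
  unfolding borel_of_def using openin_subset by (subst sets_measure_of) auto

lemma closedin_in_sets_borel_of:
  assumes "closedin T C"
  shows "C \<in> sets (borel_of T)"
proof -
  have "space (borel_of T) - (topspace T - C) \<in> sets (borel_of T)"
    using assms by (intro sets.compl_sets openin_in_sets_borel_of) (simp add: closedin_def)
  then show ?thesis
    using closedin_subset[OF assms] by (simp add: double_diff)
qed

lemma borel_of_euclidean [simp]: "borel_of euclidean = borel"
  by (simp add: borel_of_def borel_def)

lemma measurable_borel_of:
  assumes "continuous_map S T f"
  shows "f \<in> measurable (borel_of S) (borel_of T)"
  unfolding borel_of_def[of T]
proof (rule measurable_measure_of)
  show "f \<in> space (borel_of S) \<rightarrow> topspace T"
    using continuous_map_image_subset_topspace[OF assms] by auto
  fix U assume "U \<in> {U. openin T U}"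
  then have "openin S {x \<in> topspace S. f x \<in> U}"
    using openin_continuous_map_preimage[OF assms] by simp
  moreover have "f -` U \<inter> space (borel_of S) = {x \<in> topspace S. f x \<in> U}"
    by auto
  ultimately show "f -` U \<inter> space (borel_of S) \<in> sets (borel_of S)"
    by (simp add: openin_in_sets_borel_of)
qed (use openin_subset in auto)

lemma tendsto_integral_locally_compact_support:
  fixes f :: "'u::topological_space \<Rightarrow> 'b::topological_space \<Rightarrow> 'c::euclidean_space"
  assumes cont: "continuous_on UNIV (\<lambda>z. f (fst z) (snd z))"
    and sets: "sets M = sets borel"
    and L: "compact L" "L \<in> sets borel" "emeasure M L < \<infinity>"
    and U: "open U" "u0 \<in> U" "\<And>u h. u \<in> U \<Longrightarrow> h \<notin> L \<Longrightarrow> f u h = 0"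
  shows "((\<lambda>u. LINT h|M. f u h) \<longlongrightarrow> (LINT h|M. f u0 h)) (nhds u0)"
proof (rule tendstoI)
  fix e :: real assume e: "e > 0"
  define d where "d = e / (measure M L + 1)"
  have pos: "measure M L + 1 > 0"
    by (simp add: add_nonneg_pos)
  then have d: "d > 0"
    using e by (simp add: d_def)
  have "d * measure M L < d * (measure M L + 1)"
    using d by simp
  also have "\<dots> = e"
    using pos by (simp add: d_def)
  finally have d_less: "d * measure M L < e" .
  have cont_f: "continuous_on UNIV (f u)" for u
  proof -
    have "continuous_on UNIV (\<lambda>h::'b. (u, h))"
      by (rule continuous_on_Pair[OF continuous_on_const continuous_on_id])
    from continuous_on_compose2[OF cont this] show ?thesis
      by simp
  qed
  have meas: "f u \<in> borel_measurable M" for u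
    unfolding measurable_cong_sets[OF sets refl] by (rule borel_measurable_continuous_onI[OF cont_f])
  have integrable: "integrable M (f u)" if u: "u \<in> U" for u
  proof -
    have "bounded (f u ` L)"
      by (intro compact_imp_bounded compact_continuous_image L continuous_on_subset[OF cont_f]) simp
    then obtain B where "\<forall>h\<in>L. norm (f u h) \<le> B"
      unfolding bounded_iff by blast
    then show ?thesis
      using L U(3)[OF u] by (intro integrableI_bounded_set[of L M _ B] meas) (auto simp: sets)
  qed
  obtain N where N: "u0 \<in> N" "open N" "\<forall>u\<in>N \<inter> UNIV. \<forall>h\<in>L. dist (f u h) (f u0 h) \<le> d"
    by (rule continuous_on_prod_compactE[of UNIV L "\<lambda>z. f (fst z) (snd z)" u0 d])
       (use cont L d in \<open>auto intro: continuous_on_subset\<close>)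
  have "dist (LINT h|M. f u h) (LINT h|M. f u0 h) < e" if u: "u \<in> N \<inter> U" for u
  proof -
    have int: "integrable M (\<lambda>h. f u h - f u0 h)"
      using u U(2) by (intro Bochner_Integration.integrable_diff integrable) auto
    have "norm (LINT h|M. f u h - f u0 h) \<le> (LINT h|M. norm (f u h - f u0 h))"
      by (rule integral_norm_bound)
    also have "\<dots> \<le> (LINT h|M. d * indicator L h)"
    proof (rule integral_mono)
      show "integrable M (\<lambda>h. norm (f u h - f u0 h))"
        by (rule integrable_norm[OF int])
      show "integrable M (\<lambda>h. d * indicator L h)"
        using L by (intro integrable_mult_right integrable_real_indicator) (auto simp: sets)
      fix h
      show "norm (f u h - f u0 h) \<le> d * indicator L h"
        using N(3) u U(2) U(3)[of u h] U(3)[of u0 h] by (auto simp: indicator_def dist_norm)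
    qed
    also have "\<dots> = d * measure M L"
      using L by (simp add: sets)
    finally show ?thesis
      using d_less u U(2) by (simp add: dist_norm integrable flip: Bochner_Integration.integral_diff)
  qed
  then show "eventually (\<lambda>u. dist (LINT h|M. f u h) (LINT h|M. f u0 h) < e) (nhds u0)"
    unfolding eventually_nhds using N U by (intro exI[of _ "N \<inter> U"]) auto
qed

definition fibre_arrow :: "'a::topological_group_add \<Rightarrow> 'a universal_cover \<Rightarrow> (real \<Rightarrow> 'a) set" where
  "fibre_arrow u h = Rep_path_group (pconst u + cover_path h)"

lemma continuous_on_fibre_translate:
  "continuous_on A (\<lambda>z. pconst (fst z) + cover_path (snd z))"
  by (intro continuous_on_add continuous_on_compose2[OF continuous_on_pconst]
      continuous_on_compose2[OF continuous_on_cover_path] continuous_intros) auto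

lemma continuous_map_fibre_arrow:
  "continuous_map euclidean (garrows fundamental_groupoid) (fibre_arrow u)"
proof -
  have "continuous_map euclidean euclidean (\<lambda>h. pconst u + cover_path h)"
    by (simp, intro continuous_on_add continuous_on_const continuous_on_cover_path)
  from continuous_map_compose[OF this continuous_map_Rep_path_group]
  show ?thesis
    by (simp add: o_def fibre_arrow_def[abs_def])
qed

lemma measurable_fibre_arrow:
  "fibre_arrow u \<in> measurable borel (borel_of (garrows fundamental_groupoid))"
  using measurable_borel_of[OF continuous_map_fibre_arrow] by simp

lemma inj_fibre_arrow: "inj (fibre_arrow u)"
  by (simp add: inj_on_def fibre_arrow_def Rep_path_group_inject cover_path_inject)

lemma range_fibre_arrow: "range (fibre_arrow u) = range_fibre fundamental_groupoid u"
proof (intro equalityI subsetI)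
  fix c assume "c \<in> range_fibre fundamental_groupoid u"
  then obtain x where x: "c = Rep_path_group x" "prange x = u"
    by (auto simp: range_fibre_def)
  then have "c = fibre_arrow u (Abs_cover (- pconst u + x))"
    by (simp add: fibre_arrow_def flip: add.assoc)
  then show "c \<in> range (fibre_arrow u)"
    by simp
qed (auto simp: range_fibre_def fibre_arrow_def)

lemma compact_vimage_Rep_path_group:
  assumes "compactin (garrows fundamental_groupoid) C"
  shows "compact (Rep_path_group -` C)"
proof -
  have "compact (Abs_path_group ` C)"
    using image_compactin[OF assms continuous_map_Abs_path_group] by simp
  moreover have "Abs_path_group ` C = Rep_path_group -` C"
  proof (intro equalityI subsetI)
    fix x assume "x \<in> Abs_path_group ` C"
    then show "x \<in> Rep_path_group -` C"
      using compactin_subset_topspace[OF assms] by (auto simp: Rep_path_group_inverse)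
  next
    fix x assume "x \<in> Rep_path_group -` C"
    then have "Abs_path_group (Rep_path_group x) \<in> Abs_path_group ` C"
      by blast
    then show "x \<in> Abs_path_group ` C"
      by (simp add: Rep_path_group_inverse)
  qed
  ultimately show ?thesis
    by simp
qed

lemma compact_vimage_fibre_arrow:
  fixes C :: "(real \<Rightarrow> 'a::{topological_group_add, t2_space}) set set"
  assumes "compactin (garrows fundamental_groupoid) C"
  shows "compact (fibre_arrow u -` C)"
proof -
  have "fibre_arrow u -` C = cover_path -` (+) (- pconst u) ` Rep_path_group -` C"
    by (auto simp: fibre_arrow_def mem_translate_iff)
  then show ?thesis
    using compact_vimage_Rep_path_group[OF assms]
    by (simp add: compact_vimage_cover_path compact_translate)
qed

text \<open>Open sets of a range fibre extend to open sets of arrows because the range fibre is closed.\<close>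

lemma open_fibre_arrow_extend:
  fixes A :: "(real \<Rightarrow> 'a::{topological_group_add, t2_space}) set set"
  assumes W: "open W" "fibre_arrow u -` A \<subseteq> W" and A: "A \<subseteq> topspace (garrows fundamental_groupoid)"
  obtains U where "openin (garrows fundamental_groupoid) U" "A \<subseteq> U" "fibre_arrow u -` U = W"
proof -
  obtain T where T: "open T" "W = cover_path -` T"
    using W(1) unfolding open_universal_cover_def by blast
  define Z where "Z = (+) (pconst u) ` T \<union> {x. prange x \<noteq> u}"
  have "open ((prange :: 'a path_group \<Rightarrow> 'a) -` (- {u}))"
    by (intro open_vimage continuous_on_prange) (simp add: open_Compl)
  moreover have "prange -` (- {u}) = {x :: 'a path_group. prange x \<noteq> u}"
    by auto
  ultimately have "open Z"
    unfolding Z_def using open_translate[OF T(1)] by (intro open_Un) auto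
  then have "openin (garrows fundamental_groupoid) (Rep_path_group ` Z)"
    by (simp add: garrows_fundamental_groupoid open_path_group_def)
  moreover have "A \<subseteq> Rep_path_group ` Z"
  proof
    fix c assume c: "c \<in> A"
    then obtain x where x: "c = Rep_path_group x"
      using A by auto
    have "x \<in> Z"
    proof (cases "prange x = u")
      case True
      then have "c \<in> range (fibre_arrow u)"
        using x by (auto simp: range_fibre_arrow range_fibre_def)
      then obtain h where h: "c = fibre_arrow u h"
        by blast
      then have "h \<in> W"
        using W(2) c by auto
      moreover have "x = pconst u + cover_path h"
        using h x by (simp add: fibre_arrow_def Rep_path_group_inject)
      ultimately show ?thesis
        by (simp add: Z_def T(2))
    qed (simp add: Z_def)
    then show "c \<in> Rep_path_group ` Z"
      by (simp add: x)
  qed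
  moreover have "fibre_arrow u -` Rep_path_group ` Z = W"
  proof -
    have "fibre_arrow u h \<in> Rep_path_group ` Z \<longleftrightarrow> pconst u + cover_path h \<in> Z" for h
      by (auto simp: fibre_arrow_def Rep_path_group_inject)
    moreover have "pconst u + cover_path h \<in> Z \<longleftrightarrow> h \<in> W" for h
      by (simp add: Z_def mem_translate_iff T(2))
    ultimately show ?thesis
      by auto
  qed
  ultimately show thesis
    by (rule that)
qed

theorem theorem2p3:
  assumes "path_connected (UNIV :: 'a::{topological_group_add, t2_space} set)"
    and "locally path_connected (UNIV :: 'a set)"
    and "semilocally_simply_connected (UNIV :: 'a set)"
    and "locally_compact_space (euclidean :: 'a topology)"
  shows "\<exists>\<alpha>. haar_system (fundamental_groupoid :: ('a, (real \<Rightarrow> 'a) set) groupoid) \<alpha>"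
proof -
  define G where "G = (fundamental_groupoid :: ('a, (real \<Rightarrow> 'a) set) groupoid)"
  have space_G: "topspace (garrows G) = range Rep_path_group"
    by (simp add: G_def)
  obtain M :: "'a universal_cover measure" where sets_M: "sets M = sets borel"
    and M_compact: "\<And>K. compact K \<Longrightarrow> emeasure M K < \<infinity>"
    and M_outer: "\<And>A. A \<in> sets borel \<Longrightarrow> emeasure M A = (INF U\<in>{U. open U \<and> A \<subseteq> U}. emeasure M U)"
    and M_inner: "\<And>U. open U \<Longrightarrow> emeasure M U = (SUP K\<in>{K. compact K \<and> K \<subseteq> U}. emeasure M K)"
    and M_pos: "\<And>U. open U \<Longrightarrow> U \<noteq> {} \<Longrightarrow> emeasure M U \<noteq> 0"
    and M_left: "\<And>a. distr M borel ((+) a) = M"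
    by (rule exists_left_haar_measure[OF Hausdorff_universal_cover[OF assms(3)]
        locally_compact_universal_cover[OF assms(2-4)]]) blast
  have space_M: "space M = UNIV"
    using sets_eq_imp_space_eq[OF sets_M] by simp
  note fibre_G = continuous_map_fibre_arrow[where 'a = 'a, folded G_def]
    and fibre_meas = measurable_fibre_arrow[where 'a = 'a, folded G_def]
  have fibre_M: "fibre_arrow u \<in> measurable M (borel_of (garrows G))" for u
    using fibre_meas by (simp add: measurable_cong_sets[OF sets_M refl])
  have open_vimage_fibre: "open (fibre_arrow u -` U)" if "openin (garrows G) U" for u U
    using openin_continuous_map_preimage[OF fibre_G that] by (simp add: vimage_def)
  define \<alpha> where "\<alpha> u = distr M (borel_of (garrows G)) (fibre_arrow u)" for u :: 'a
  have sets_\<alpha>: "sets (\<alpha> u) = sets (borel_of (garrows G))" for u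
    by (simp add: \<alpha>_def)
  have emeasure_\<alpha>: "emeasure (\<alpha> u) A = emeasure M (fibre_arrow u -` A)"
    if "A \<in> sets (borel_of (garrows G))" for u A
    unfolding \<alpha>_def emeasure_distr[OF fibre_M that] space_M by simp
  have meas_vimage: "fibre_arrow u -` A \<in> sets borel" if "A \<in> sets (borel_of (garrows G))" for u A
    using measurable_sets[OF fibre_meas that] by simp
  have integral_\<alpha>: "(LINT x|\<alpha> u. f x) = (LINT h|M. f (fibre_arrow u h))"
    if "f \<in> borel_measurable (borel_of (garrows G))" for u and f :: "_ \<Rightarrow> complex"
    unfolding \<alpha>_def by (rule integral_distr[OF fibre_M that])
  have continuous_meas: "f \<in> borel_measurable (borel_of (garrows G))"
    if "continuous_map (garrows G) euclidean f" for f :: "_ \<Rightarrow> complex"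
    using measurable_borel_of[OF that] by simp
  have lcg: "locally_compact_groupoid G"
    unfolding G_def by (rule locally_compact_groupoid_fundamental_groupoid[OF assms(2-4)])
  have Hausdorff: "Hausdorff_space (garrows G)"
    using lcg by (rule locally_compact_groupoid.Hausdorff_arrows)
  have radon: "radon_measure (garrows G) (\<alpha> u)" for u
    unfolding radon_measure_def
  proof (intro conjI allI impI ballI)
    show "sets (\<alpha> u) = sets (borel_of (garrows G))"
      by (rule sets_\<alpha>)
  next
    fix C assume C: "compactin (garrows G) C"
    have "C \<in> sets (borel_of (garrows G))"
      using compactin_imp_closedin[OF Hausdorff C] by (rule closedin_in_sets_borel_of)
    then show "emeasure (\<alpha> u) C < \<infinity>"
      using M_compact[OF compact_vimage_fibre_arrow[OF C[unfolded G_def]]] by (simp add: emeasure_\<alpha>)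
  next
    fix A assume "A \<in> sets (\<alpha> u)"
    then have A: "A \<in> sets (borel_of (garrows G))"
      by (simp add: sets_\<alpha>)
    show "emeasure (\<alpha> u) A = (INF U\<in>{U. openin (garrows G) U \<and> A \<subseteq> U}. emeasure (\<alpha> u) U)"
    proof (rule antisym)
      show "emeasure (\<alpha> u) A \<le> (INF U\<in>{U. openin (garrows G) U \<and> A \<subseteq> U}. emeasure (\<alpha> u) U)"
        by (intro INF_greatest emeasure_mono) (auto simp: sets_\<alpha> openin_in_sets_borel_of)
      show "(INF U\<in>{U. openin (garrows G) U \<and> A \<subseteq> U}. emeasure (\<alpha> u) U) \<le> emeasure (\<alpha> u) A"
        unfolding emeasure_\<alpha>[OF A] M_outer[OF meas_vimage[OF A]]
      proof (rule INF_greatest, clarify)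
        fix W assume W: "open W" "fibre_arrow u -` A \<subseteq> W"
        have "A \<subseteq> topspace (garrows G)"
          using sets.sets_into_space[OF A] by simp
        then obtain U where U: "openin (garrows G) U" "A \<subseteq> U" "fibre_arrow u -` U = W"
          using open_fibre_arrow_extend[OF W, folded G_def] by metis
        have "emeasure (\<alpha> u) U = emeasure M W"
          by (simp add: emeasure_\<alpha> openin_in_sets_borel_of U)
        then show "(INF U\<in>{U. openin (garrows G) U \<and> A \<subseteq> U}. emeasure (\<alpha> u) U) \<le> emeasure M W"
          using U by (intro INF_lower2[of U]) auto
      qed
    qed
  next
    fix U assume U: "openin (garrows G) U"
    show "emeasure (\<alpha> u) U = (SUP K\<in>{K. compactin (garrows G) K \<and> K \<subseteq> U}. emeasure (\<alpha> u) K)"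
    proof (rule antisym)
      show "(SUP K\<in>{K. compactin (garrows G) K \<and> K \<subseteq> U}. emeasure (\<alpha> u) K) \<le> emeasure (\<alpha> u) U"
        using U by (intro SUP_least emeasure_mono) (auto simp: sets_\<alpha> openin_in_sets_borel_of)
      show "emeasure (\<alpha> u) U \<le> (SUP K\<in>{K. compactin (garrows G) K \<and> K \<subseteq> U}. emeasure (\<alpha> u) K)"
        unfolding emeasure_\<alpha>[OF openin_in_sets_borel_of[OF U]] M_inner[OF open_vimage_fibre[OF U]]
      proof (rule SUP_least, clarify)
        fix K assume K: "compact K" "K \<subseteq> fibre_arrow u -` U"
        have C: "compactin (garrows G) (fibre_arrow u ` K)"
          using image_compactin[OF _ fibre_G, of K] K(1) by simp
        have "fibre_arrow u ` K \<in> sets (borel_of (garrows G))"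
          using compactin_imp_closedin[OF Hausdorff C] by (rule closedin_in_sets_borel_of)
        then have "emeasure (\<alpha> u) (fibre_arrow u ` K) = emeasure M K"
          by (simp add: emeasure_\<alpha> inj_vimage_image_eq[OF inj_fibre_arrow])
        then show "emeasure M K \<le> (SUP K\<in>{K. compactin (garrows G) K \<and> K \<subseteq> U}. emeasure (\<alpha> u) K)"
          using C K(2) by (intro SUP_upper2[of "fibre_arrow u ` K"]) auto
      qed
    qed
  qed
  have support: "measure_support (garrows G) (\<alpha> u) = range_fibre G u" for u
  proof -
    have null_iff: "emeasure (\<alpha> u) U = 0 \<longleftrightarrow> U \<inter> range_fibre G u = {}" if U: "openin (garrows G) U" for U
    proof -
      have "emeasure (\<alpha> u) U = emeasure M (fibre_arrow u -` U)"
        by (rule emeasure_\<alpha>[OF openin_in_sets_borel_of[OF U]])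
      moreover have "fibre_arrow u -` U = {} \<longleftrightarrow> U \<inter> range_fibre G u = {}"
        unfolding G_def range_fibre_arrow[symmetric] by blast
      ultimately show ?thesis
        using M_pos[OF open_vimage_fibre[OF U]] by (metis emeasure_empty)
    qed
    obtain U where U: "openin (garrows G) U" "topspace (garrows G) - range_fibre G u \<subseteq> U"
        "fibre_arrow u -` U = {}"
    proof (rule open_fibre_arrow_extend[of "{}" u "topspace (garrows G) - range_fibre G u", folded G_def])
      show "fibre_arrow u -` (topspace (garrows G) - range_fibre G u) \<subseteq> {}"
        unfolding G_def range_fibre_arrow[symmetric] by auto
    qed auto
    have "U \<inter> range_fibre G u = {}"
      using U(3) unfolding G_def range_fibre_arrow[symmetric] by blast
    moreover have "range_fibre G u \<subseteq> topspace (garrows G)"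
      by (auto simp: range_fibre_def)
    ultimately show ?thesis
      unfolding measure_support_def using U(1,2) null_iff by blast
  qed
  have continuity: "(\<lambda>u. LINT x|\<alpha> u. f x) \<in> continuous_compact_support (gunits G)"
    if f: "f \<in> continuous_compact_support (garrows G)" for f
  proof -
    have cont_f: "continuous_map (garrows G) euclidean f"
      using f by (simp add: continuous_compact_support_def)
    define g where "g x = f (Rep_path_group x)" for x
    have cont_g: "continuous_on UNIV g"
      using continuous_map_compose[OF continuous_map_Rep_path_group cont_f[unfolded G_def]]
      by (simp add: o_def g_def[abs_def])
    define S where "S = Rep_path_group -` (garrows G closure_of {x \<in> topspace (garrows G). f x \<noteq> 0})"
    have S: "compact S"
      unfolding S_def using f compact_vimage_Rep_path_group
      by (auto simp: continuous_compact_support_def G_def)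
    have g_zero: "g x = 0" if "x \<notin> S" for x
    proof (rule ccontr)
      assume "g x \<noteq> 0"
      then have "Rep_path_group x \<in> {x \<in> topspace (garrows G). f x \<noteq> 0}"
        by (simp add: g_def space_G)
      then have "Rep_path_group x \<in> garrows G closure_of {x \<in> topspace (garrows G). f x \<noteq> 0}"
        using closure_of_subset[of "{x \<in> topspace (garrows G). f x \<noteq> 0}" "garrows G"] by blast
      then show False
        using that by (simp add: S_def)
    qed
    define F where "F u = (LINT h|M. g (pconst u + cover_path h))" for u
    have F: "(\<lambda>u. LINT x|\<alpha> u. f x) = F"
      unfolding F_def g_def using integral_\<alpha>[OF continuous_meas[OF cont_f]]
      by (simp add: fibre_arrow_def)
    have "isCont F u0" for u0
    proof -
      obtain U C where U: "open U" "u0 \<in> U" "U \<subseteq> C" and C: "compact C"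
        using assms(4)[unfolded locally_compact_space_def, rule_format, of u0] by auto
      define L where "L = cover_path -` ((\<lambda>z. - pconst (fst z) + snd z) ` (C \<times> S))"
      have "continuous_on (C \<times> S) (\<lambda>z. - pconst (fst z) + snd z)"
        by (intro continuous_intros continuous_on_compose2[OF continuous_on_pconst]) auto
      then have L: "compact L"
        unfolding L_def by (intro compact_vimage_cover_path compact_continuous_image compact_Times C S)
      have "L \<in> sets borel"
        using Hausdorff_compact_imp_closed[OF Hausdorff_universal_cover[OF assms(3)] L]
        by (rule borel_closed)
      moreover have "continuous_on UNIV (\<lambda>z. g (pconst (fst z) + cover_path (snd z)))"
        by (rule continuous_on_compose2[OF cont_g continuous_on_fibre_translate]) simp
      moreover have "g (pconst u + cover_path h) = 0" if "u \<in> U" "h \<notin> L" for u h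
      proof (rule g_zero, rule notI)
        assume "pconst u + cover_path h \<in> S"
        then have "(u, pconst u + cover_path h) \<in> C \<times> S"
          using that(1) U(3) by auto
        then have "- pconst u + (pconst u + cover_path h) \<in> (\<lambda>z. - pconst (fst z) + snd z) ` (C \<times> S)"
          by (rule rev_image_eqI) simp
        then show False
          using that(2) by (simp add: L_def)
      qed
      ultimately have "(F \<longlongrightarrow> F u0) (nhds u0)"
        unfolding F_def
        by (intro tendsto_integral_locally_compact_support[OF _ sets_M L _ M_compact[OF L] U(1,2)])
      then show ?thesis
        unfolding isCont_def by (rule tendsto_mono[rotated]) (simp add: at_within_def)
    qed
    then have cont_F: "continuous_on UNIV F"
      by (simp add: continuous_at_imp_continuous_on)
    have "{u. F u \<noteq> 0} \<subseteq> prange ` S"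
    proof
      fix u assume u: "u \<in> {u. F u \<noteq> 0}"
      have "\<exists>h. pconst u + cover_path h \<in> S"
      proof (rule ccontr)
        assume "\<not> ?thesis"
        then have "F u = 0"
          unfolding F_def using g_zero by simp
        with u show False
          by simp
      qed
      then obtain h where "pconst u + cover_path h \<in> S" ..
      then have "prange (pconst u + cover_path h) \<in> prange ` S"
        by (rule imageI)
      then show "u \<in> prange ` S"
        by simp
    qed
    moreover have compact_image: "compact (prange ` S)"
      by (intro compact_continuous_image S continuous_on_subset[OF continuous_on_prange]) simp
    ultimately have "closure {u. F u \<noteq> 0} \<subseteq> prange ` S"
      by (intro closure_minimal compact_imp_closed)
    then have "compact (closure {u. F u \<noteq> 0})"
      using compact_Int_closed[OF compact_image closed_closure, of "{u. F u \<noteq> 0}"] by (simp add: inf_absorb2)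
    then show ?thesis
      using cont_F unfolding F continuous_compact_support_def by (simp add: G_def)
  qed
  have left_invariance:
    "(LINT y:range_fibre G (gsource G x)|\<alpha> (gsource G x). f (gmult G x y)) =
     (LINT y:range_fibre G (grange G x)|\<alpha> (grange G x). f y)"
    if x: "x \<in> topspace (garrows G)" and f: "f \<in> continuous_compact_support (garrows G)" for x f
  proof -
    obtain z where z: "x = Rep_path_group z"
      using x space_G by auto
    define s where "s = psource z"
    define r where "r = prange z"
    have sr: "gsource G x = s" "grange G x = r"
      by (simp_all add: G_def z s_def r_def)
    have cont_f: "continuous_map (garrows G) euclidean f"
      using f by (simp add: continuous_compact_support_def)
    have fibre_sets: "range_fibre G u \<in> sets (borel_of (garrows G))" for u
    proof -
      have "closedin (garrows G) {y \<in> topspace (garrows G). grange G y \<in> {u}}"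
      proof (rule closedin_continuous_map_preimage)
        show "continuous_map (garrows G) euclidean (grange G)"
          using topological_groupoid.continuous_range[OF topological_groupoid_fundamental_groupoid[where 'a = 'a]]
          by (simp add: G_def)
      qed simp
      then show ?thesis
        using closedin_in_sets_borel_of by (simp add: range_fibre_def)
    qed
    have fibre_integral: "(LINT y:range_fibre G u|\<alpha> u. k y) = (LINT h|M. k (fibre_arrow u h))"
      if "k \<in> borel_measurable (borel_of (garrows G))" for u and k :: "_ \<Rightarrow> complex"
    proof -
      have "fibre_arrow u h \<in> range_fibre G u" for h
        unfolding G_def range_fibre_arrow[symmetric] by simp
      then show ?thesis
        unfolding set_lebesgue_integral_def using that fibre_sets
        by (subst integral_\<alpha>) (auto intro: borel_measurable_scaleR borel_measurable_indicator)
    qed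
    define k where "k y = f (Rep_path_group (z - pconst s + Abs_path_group y))" for y
    have "continuous_map euclidean euclidean (\<lambda>w. z - pconst s + w)"
      by (simp, intro continuous_intros)
    from continuous_map_compose[OF continuous_map_compose[OF continuous_map_compose[OF
          continuous_map_Abs_path_group this] continuous_map_Rep_path_group] cont_f[unfolded G_def]]
    have cont_k: "continuous_map (garrows G) euclidean k"
      by (simp add: o_def k_def[abs_def] G_def)
    have gmult_eq: "f (gmult G x y) = k y" if y: "y \<in> range_fibre G s" for y
    proof -
      obtain w where w: "y = Rep_path_group w"
        using y space_G by (auto simp: range_fibre_def)
      then have "prange w = s"
        using y by (simp add: range_fibre_def G_def)
      then show ?thesis
        by (simp add: w z G_def k_def Rep_path_group_inverse s_def)
    qed
    define a where "a = Abs_cover (- pconst r + z)"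
    have a: "cover_path a = - pconst r + z"
      by (simp add: a_def r_def)
    have k_arrow: "k (fibre_arrow s h) = f (fibre_arrow r (a + h))" for h
      by (simp add: k_def fibre_arrow_def Rep_path_group_inverse a diff_conv_add_uminus add.assoc
          del: add_uminus_conv_diff)
    have f_meas: "(\<lambda>h. f (fibre_arrow r h)) \<in> borel_measurable borel"
      using measurable_compose[OF fibre_meas continuous_meas[OF cont_f]] .
    have shift_meas: "(+) a \<in> measurable M borel"
      unfolding measurable_cong_sets[OF sets_M refl]
      by (intro borel_measurable_continuous_onI continuous_intros)
    have "(LINT y:range_fibre G s|\<alpha> s. f (gmult G x y)) = (LINT y:range_fibre G s|\<alpha> s. k y)"
      unfolding set_lebesgue_integral_def using gmult_eq
      by (intro Bochner_Integration.integral_cong) (auto simp: indicator_def)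
    also have "\<dots> = (LINT h|M. k (fibre_arrow s h))"
      by (rule fibre_integral[OF continuous_meas[OF cont_k]])
    also have "\<dots> = (LINT h|M. f (fibre_arrow r (a + h)))"
      by (simp add: k_arrow)
    also have "\<dots> = (LINT h|distr M borel ((+) a). f (fibre_arrow r h))"
      by (rule integral_distr[OF shift_meas f_meas, symmetric])
    also have "\<dots> = (LINT h|M. f (fibre_arrow r h))"
      by (simp only: M_left)
    also have "\<dots> = (LINT y:range_fibre G r|\<alpha> r. f y)"
      by (rule fibre_integral[OF continuous_meas[OF cont_f], symmetric])
    finally show ?thesis
      by (simp only: sr)
  qed
  have "haar_system G \<alpha>"
    using lcg radon support continuity left_invariance
    by (intro haar_system.intro haar_system_axioms.intro)
  then show ?thesis
    unfolding G_def by blast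
qed

end
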